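(* Let $n$ be of the form $n=2^{r}m$ with $m$ odd and $r\in\{0,1\}$. Let $S=\mathcal{PD}_K(\phi,f)$ be a transversal Poncelet-Darboux curve of degree $n-1$ with respect to the conic $K$, where $\phi$ and $f$ are complex polynomials of degree $n$ without common zeros, and write $\Phi_t(z)=\phi(z)+tf(z)$. (i) If $r=0$, $n=2k+1$, and there exist four distinct values $t_1,t_2,t_3,t_4$ such that $\deg\gcd\big(\Phi_{t_i},\frac{d}{dz}\Phi_{t_i}\big)=k$ for $i=1,2,3,4$, then $S$ is completely decomposed into $k$ conics. (ii) If $r=1$, $n=2k$, and there exist four distinct values $t_1,t_2,t_3,t_4$ such that $\deg\gcd\big(\Phi_{t_i},\frac{d}{dz}\Phi_{t_i}\big)=k$ for $i=1,2$ and $\deg\gcd\big(\Phi_{t_i},\frac{d}{dz}\Phi_{t_i}\big)=k-1$ for $i=3,4$, then $S$ is completely decomposed into $k-1$ conics and a line.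
   Context: $K$ is the conic $z_1^2=4z_0z_2$ in $\mathbb{CP}^2$ with homogeneous coordinates $(z_0,z_1,z_2)$; its tangent lines are $z_2s^2+z_1s+z_0=0$. The Darboux coordinates $(\rho,\rho_1)$ of a point $(z_0,z_1,z_2)$ are the two roots in $s$ of $z_2s^2+z_1s+z_0=0$, i.e. $z_0/(\rho\rho_1)=-z_1/(\rho+\rho_1)=z_2$. The Poncelet-Darboux curve $\mathcal{PD}_K(\phi,f)$ is the curve of degree $n-1$ given in Darboux coordinates by $f(\rho)/\phi(\rho)=f(\rho_1)/\phi(\rho_1)$ with the factor $\rho-\rho_1$ removed, i.e. by $\dfrac{\phi(\rho)f(\rho_1)-\phi(\rho_1)f(\rho)}{\rho-\rho_1}=0$ (a symmetric polynomial of degree $n-1$ in each variable, hence a form of degree $n-1$ in $z_0,z_1,z_2$). Such a curve is called transversal if it intersects $K$ transversally at every intersection point; equivalently (for $\phi,f$ without common zeros), every polynomial in the pencil generated by $\phi$ and $f$ has roots of multiplicity at most $2$. "Conics" in a complete decomposition are irreducible conics; complete decomposition means that $S$ is the union of the indicated curves. *)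

theory Defs
  imports "HOL-Analysis.Analysis" "HOL-Computational_Algebra.Polynomial_Factorial"
    "HOL-Computational_Algebra.Field_as_Ring"
begin

text \<open>
  Ternary forms are represented by the polynomial functions they induce, which is faithful over
  the infinite field of complex numbers. A plane projective curve is given by a form; its points
  are given by their homogeneous coordinates, so that a subset of the projective plane appears as
  the set of all homogeneous coordinate triples of its points (a cone without the origin).
\<close>

type_synonym ternary = "complex \<Rightarrow> complex \<Rightarrow> complex \<Rightarrow> complex"

definition is_form :: "nat \<Rightarrow> ternary \<Rightarrow> bool" where
  "is_form d F \<longleftrightarrow>
     (\<exists>c :: nat \<Rightarrow> nat \<Rightarrow> complex. \<forall>z0 z1 z2.
        F z0 z1 z2 = (\<Sum>i\<le>d. \<Sum>j\<le>d - i. c i j * z0 ^ i * z1 ^ j * z2 ^ (d - i - j)))"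

definition curve :: "ternary \<Rightarrow> (complex \<times> complex \<times> complex) set" where
  "curve F = {(z0, z1, z2). (z0, z1, z2) \<noteq> (0, 0, 0) \<and> F z0 z1 z2 = 0}"

definition irreducible_form :: "nat \<Rightarrow> ternary \<Rightarrow> bool" where
  "irreducible_form d F \<longleftrightarrow>
     0 < d \<and> is_form d F \<and> (\<exists>z0 z1 z2. F z0 z1 z2 \<noteq> 0) \<and>
     \<not> (\<exists>a b A B. 0 < a \<and> 0 < b \<and> a + b = d \<and> is_form a A \<and> is_form b B \<and>
          (\<forall>z0 z1 z2. F z0 z1 z2 = A z0 z1 z2 * B z0 z1 z2))"

abbreviation irreducible_conic :: "ternary \<Rightarrow> bool" where
  "irreducible_conic \<equiv> irreducible_form 2"

definition line :: "ternary \<Rightarrow> bool" where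
  "line L \<longleftrightarrow> is_form 1 L \<and> (\<exists>z0 z1 z2. L z0 z1 z2 \<noteq> 0)"

definition conic_K :: ternary where
  "conic_K z0 z1 z2 = z1\<^sup>2 - 4 * z0 * z2"

definition d0 :: "ternary \<Rightarrow> ternary" where
  "d0 F z0 z1 z2 = deriv (\<lambda>w. F w z1 z2) z0"

definition d1 :: "ternary \<Rightarrow> ternary" where
  "d1 F z0 z1 z2 = deriv (\<lambda>w. F z0 w z2) z1"

definition d2 :: "ternary \<Rightarrow> ternary" where
  "d2 F z0 z1 z2 = deriv (\<lambda>w. F z0 z1 w) z2"

text \<open>
  Linear independence of the two gradients at a common point says that both curves are smooth
  there and that their tangent lines are distinct.
\<close>

definition transversal :: "ternary \<Rightarrow> ternary \<Rightarrow> bool" where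
  "transversal F G \<longleftrightarrow>
     (\<forall>(z0, z1, z2) \<in> curve F \<inter> curve G. \<forall>a b.
        a * d0 F z0 z1 z2 + b * d0 G z0 z1 z2 = 0 \<and>
        a * d1 F z0 z1 z2 + b * d1 G z0 z1 z2 = 0 \<and>
        a * d2 F z0 z1 z2 + b * d2 G z0 z1 z2 = 0 \<longrightarrow> a = 0 \<and> b = 0)"

text \<open>
  The point with Darboux coordinates \<open>x\<close>, \<open>y\<close> is \<open>(x * y, - (x + y), 1)\<close>. These
  points miss only the line \<open>z2 = 0\<close> (where a Darboux coordinate is infinite); since the
  degree of the form is prescribed, the form is nevertheless determined by its values at them,
  see \<open>poncelet_darboux_ex1\<close> below. Writing the quotient by \<open>x - y\<close> as a product
  covers the diagonal as well, by continuity.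
\<close>

definition poncelet_darboux ::
  "nat \<Rightarrow> complex poly \<Rightarrow> complex poly \<Rightarrow> ternary \<Rightarrow> bool" where
  "poncelet_darboux n \<phi> f S \<longleftrightarrow>
     is_form (n - 1) S \<and>
     (\<forall>x y. (x - y) * S (x * y) (- (x + y)) 1 = poly \<phi> x * poly f y - poly \<phi> y * poly f x)"

definition pencil :: "complex poly \<Rightarrow> complex poly \<Rightarrow> complex \<Rightarrow> complex poly" where
  "pencil \<phi> f t = \<phi> + smult t f"

text \<open>
  The union is required for the point sets, with pairwise distinct components, and also for the
  equations, so that every component occurs with multiplicity one. The constant is needed for
  the empty list.
\<close>

definition completely_decomposed :: "ternary \<Rightarrow> ternary list \<Rightarrow> bool" where
  "completely_decomposed S Cs \<longleftrightarrow>
     distinct (map curve Cs) \<and>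
     curve S = (\<Union>C \<in> set Cs. curve C) \<and>
     (\<exists>c. c \<noteq> 0 \<and> (\<forall>z0 z1 z2. S z0 z1 z2 = c * (\<Prod>C\<leftarrow>Cs. C z0 z1 z2)))"

lemma is_form_zero: "is_form d (\<lambda>_ _ _. 0)"
  unfolding is_form_def by (rule exI[of _ "\<lambda>_ _. 0"]) simp

lemma is_form_add:
  assumes "is_form d F" "is_form d G"
  shows "is_form d (\<lambda>x y z. F x y z + G x y z)"
proof -
  obtain a b where
    "\<And>x y z. F x y z = (\<Sum>i\<le>d. \<Sum>j\<le>d - i. a i j * x ^ i * y ^ j * z ^ (d - i - j))"
    "\<And>x y z. G x y z = (\<Sum>i\<le>d. \<Sum>j\<le>d - i. b i j * x ^ i * y ^ j * z ^ (d - i - j))"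
    using assms unfolding is_form_def by blast
  then show ?thesis
    unfolding is_form_def
    by (intro exI[of _ "\<lambda>i j. a i j + b i j"]) (simp add: algebra_simps sum.distrib)
qed

lemma is_form_scale:
  assumes "is_form d F"
  shows "is_form d (\<lambda>x y z. s * F x y z)"
proof -
  obtain a where
    "\<And>x y z. F x y z = (\<Sum>i\<le>d. \<Sum>j\<le>d - i. a i j * x ^ i * y ^ j * z ^ (d - i - j))"
    using assms unfolding is_form_def by blast
  then show ?thesis
    unfolding is_form_def
    by (intro exI[of _ "\<lambda>i j. s * a i j"]) (simp add: sum_distrib_left mult.assoc)
qed

lemma is_form_sum:
  assumes "\<And>i. i \<in> A \<Longrightarrow> is_form d (F i)"
  shows "is_form d (\<lambda>x y z. \<Sum>i\<in>A. F i x y z)"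
  using assms by (induction A rule: infinite_finite_induct) (auto intro: is_form_zero is_form_add)

lemma is_form_mult_z0:
  assumes "is_form d F"
  shows "is_form (Suc d) (\<lambda>x y z. x * F x y z)"
proof -
  obtain a where a:
    "\<And>x y z. F x y z = (\<Sum>i\<le>d. \<Sum>j\<le>d - i. a i j * x ^ i * y ^ j * z ^ (d - i - j))"
    using assms unfolding is_form_def by blast
  show ?thesis
    unfolding is_form_def a
    by (intro exI[of _ "\<lambda>i j. case i of 0 \<Rightarrow> 0 | Suc i' \<Rightarrow> a i' j"])
      (simp only: sum.atMost_Suc_shift sum_distrib_left, simp add: mult_ac)
qed

lemma is_form_mult_z1:
  assumes "is_form d F"
  shows "is_form (Suc d) (\<lambda>x y z. y * F x y z)"
proof -
  obtain a where a:
    "\<And>x y z. F x y z = (\<Sum>i\<le>d. \<Sum>j\<le>d - i. a i j * x ^ i * y ^ j * z ^ (d - i - j))"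
    using assms unfolding is_form_def by blast
  define b where "b = (\<lambda>i j. case j of 0 \<Rightarrow> 0 | Suc j' \<Rightarrow> a i j')"
  have inner: "y * (\<Sum>j\<le>d - i. a i j * x ^ i * y ^ j * z ^ (d - i - j)) =
      (\<Sum>j\<le>Suc d - i. b i j * x ^ i * y ^ j * z ^ (Suc d - i - j))" if "i \<le> d" for i x y z
  proof -
    have "Suc d - i = Suc (d - i)" using that by simp
    then show ?thesis
      by (simp add: sum.atMost_Suc_shift sum_distrib_left b_def mult_ac del: sum.atMost_Suc)
  qed
  have "y * (\<Sum>i\<le>d. \<Sum>j\<le>d - i. a i j * x ^ i * y ^ j * z ^ (d - i - j)) =
      (\<Sum>i\<le>Suc d. \<Sum>j\<le>Suc d - i. b i j * x ^ i * y ^ j * z ^ (Suc d - i - j))" for x y z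
  proof -
    have "y * (\<Sum>i\<le>d. \<Sum>j\<le>d - i. a i j * x ^ i * y ^ j * z ^ (d - i - j)) =
      (\<Sum>i\<le>d. y * (\<Sum>j\<le>d - i. a i j * x ^ i * y ^ j * z ^ (d - i - j)))"
      by (rule sum_distrib_left)
    also have "\<dots> = (\<Sum>i\<le>d. \<Sum>j\<le>Suc d - i. b i j * x ^ i * y ^ j * z ^ (Suc d - i - j))"
      by (intro sum.cong refl inner) simp
    also have "\<dots> =
      (\<Sum>i\<le>Suc d. \<Sum>j\<le>Suc d - i. b i j * x ^ i * y ^ j * z ^ (Suc d - i - j))"
      by (subst sum.atMost_Suc) (simp add: b_def)
    finally show ?thesis .
  qed
  then show ?thesis
    unfolding is_form_def a by blast
qed

lemma is_form_mult_z2: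
  assumes "is_form d F"
  shows "is_form (Suc d) (\<lambda>x y z. z * F x y z)"
proof -
  obtain a where a:
    "\<And>x y z. F x y z = (\<Sum>i\<le>d. \<Sum>j\<le>d - i. a i j * x ^ i * y ^ j * z ^ (d - i - j))"
    using assms unfolding is_form_def by blast
  define b where "b = (\<lambda>i j. if i + j = Suc d then 0 else a i j)"
  have inner: "z * (\<Sum>j\<le>d - i. a i j * x ^ i * y ^ j * z ^ (d - i - j)) =
      (\<Sum>j\<le>Suc d - i. b i j * x ^ i * y ^ j * z ^ (Suc d - i - j))" if "i \<le> d" for i x y z
  proof -
    have *: "Suc d - i = Suc (d - i)" using that by simp
    have "(\<Sum>j\<le>d - i. z * (a i j * x ^ i * y ^ j * z ^ (d - i - j))) =
      (\<Sum>j\<le>d - i. b i j * x ^ i * y ^ j * z ^ (Suc d - i - j))"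
      using that by (intro sum.cong refl) (auto simp: b_def Suc_diff_le)
    moreover have "b i (Suc (d - i)) = 0" using that by (simp add: b_def)
    ultimately show ?thesis by (simp add: * sum_distrib_left)
  qed
  have "z * (\<Sum>i\<le>d. \<Sum>j\<le>d - i. a i j * x ^ i * y ^ j * z ^ (d - i - j)) =
      (\<Sum>i\<le>Suc d. \<Sum>j\<le>Suc d - i. b i j * x ^ i * y ^ j * z ^ (Suc d - i - j))" for x y z
  proof -
    have "z * (\<Sum>i\<le>d. \<Sum>j\<le>d - i. a i j * x ^ i * y ^ j * z ^ (d - i - j)) =
      (\<Sum>i\<le>d. z * (\<Sum>j\<le>d - i. a i j * x ^ i * y ^ j * z ^ (d - i - j)))"
      by (rule sum_distrib_left)
    also have "\<dots> = (\<Sum>i\<le>d. \<Sum>j\<le>Suc d - i. b i j * x ^ i * y ^ j * z ^ (Suc d - i - j))"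
      by (intro sum.cong refl inner) simp
    also have "\<dots> =
      (\<Sum>i\<le>Suc d. \<Sum>j\<le>Suc d - i. b i j * x ^ i * y ^ j * z ^ (Suc d - i - j))"
      by (subst sum.atMost_Suc) (simp add: b_def)
    finally show ?thesis .
  qed
  then show ?thesis
    unfolding is_form_def a by blast
qed

lemma is_form_mult_powers:
  assumes "is_form d F"
  shows "is_form (p + q + d) (\<lambda>x y z. x ^ p * z ^ q * F x y z)"
proof (induction p)
  case 0
  show ?case
  proof (induction q)
    case 0
    show ?case using assms by simp
  next
    case (Suc q)
    show ?case using is_form_mult_z2[OF Suc.IH] by (simp add: mult_ac)
  qed
next
  case (Suc p)
  show ?case using is_form_mult_z0[OF Suc.IH] by (simp add: mult_ac)
qed

text \<open>The complete homogeneous symmetric polynomials in the Darboux coordinates.\<close>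

fun complete_sym :: "nat \<Rightarrow> ternary" where
  "complete_sym 0 x y z = 1"
| "complete_sym (Suc 0) x y z = - y"
| "complete_sym (Suc (Suc k)) x y z =
     - y * complete_sym (Suc k) x y z - x * z * complete_sym k x y z"

lemma is_form_complete_sym: "is_form k (complete_sym k)"
proof (induction k rule: less_induct)
  case (less k)
  have one: "is_form 0 (\<lambda>x y z. 1)"
    unfolding is_form_def by (rule exI[of _ "\<lambda>_ _. 1"]) simp
  consider "k = 0" | "k = 1" | l where "k = Suc (Suc l)"
    by (metis One_nat_def not0_implies_Suc)
  then show ?case
  proof cases
    case 1
    have "complete_sym 0 = (\<lambda>x y z. 1)" by (intro ext) simp
    then show ?thesis using one 1 by simp
  next
    case 2
    have "complete_sym 1 = (\<lambda>x y z. (- 1) * (y * 1))" by (intro ext) simp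
    then show ?thesis using is_form_scale[OF is_form_mult_z1[OF one], of "- 1"] 2 by simp
  next
    case 3
    have "complete_sym k = (\<lambda>x y z. (- 1) * (y * complete_sym (Suc l) x y z)
            + (- 1) * (x * (z * complete_sym l x y z)))"
      by (intro ext) (simp add: 3)
    moreover have "is_form k (\<lambda>x y z. (- 1) * (y * complete_sym (Suc l) x y z)
            + (- 1) * (x * (z * complete_sym l x y z)))"
      unfolding 3
      by (intro is_form_add is_form_scale is_form_mult_z0 is_form_mult_z1 is_form_mult_z2 less.IH)
        (simp_all add: 3)
    ultimately show ?thesis by simp
  qed
qed

lemma complete_sym_Darboux:
  "(x - y) * complete_sym k (x * y) (- (x + y)) 1 = x ^ Suc k - y ^ Suc k"
proof (induction k rule: less_induct)
  case (less k)
  consider "k = 0" | "k = 1" | l where "k = Suc (Suc l)"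
    by (metis One_nat_def not0_implies_Suc)
  then show ?case
  proof cases
    case 3
    have "(x - y) * complete_sym k (x * y) (- (x + y)) 1 =
      (x + y) * ((x - y) * complete_sym (Suc l) (x * y) (- (x + y)) 1)
      - x * y * ((x - y) * complete_sym l (x * y) (- (x + y)) 1)"
      by (simp add: 3 algebra_simps)
    also have "\<dots> = (x + y) * (x ^ Suc (Suc l) - y ^ Suc (Suc l)) - x * y * (x ^ Suc l - y ^ Suc l)"
      using less.IH[of l] less.IH[of "Suc l"] 3 by simp
    also have "\<dots> = x ^ Suc k - y ^ Suc k"
      by (simp add: 3 algebra_simps)
    finally show ?thesis .
  qed (simp_all add: algebra_simps power2_eq_square)
qed

lemma is_form_isCont:
  assumes "is_form d F"
  shows "isCont (\<lambda>w. F w z1 z2) z0" "isCont (\<lambda>w. F z0 z1 w) z2"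
proof -
  obtain a where a:
    "\<And>x y z. F x y z = (\<Sum>i\<le>d. \<Sum>j\<le>d - i. a i j * x ^ i * y ^ j * z ^ (d - i - j))"
    using assms unfolding is_form_def by blast
  show "isCont (\<lambda>w. F w z1 z2) z0" "isCont (\<lambda>w. F z0 z1 w) z2"
    unfolding a by (intro continuous_intros)+
qed

lemma is_form_homogeneous:
  assumes "is_form d F"
  shows "F (s * x) (s * y) (s * z) = s ^ d * F x y z"
proof -
  obtain a where a:
    "\<And>x y z. F x y z = (\<Sum>i\<le>d. \<Sum>j\<le>d - i. a i j * x ^ i * y ^ j * z ^ (d - i - j))"
    using assms unfolding is_form_def by blast
  have "s ^ d = s ^ i * s ^ j * s ^ (d - i - j)" if "i \<le> d" "j \<le> d - i" for i j
    using that by (simp flip: power_add)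
  then show ?thesis
    unfolding a sum_distrib_left by (intro sum.cong refl) (simp add: power_mult_distrib)
qed

lemma isCont_eq_0:
  fixes g :: "complex \<Rightarrow> complex"
  assumes "isCont g a" and "\<And>w. w \<noteq> a \<Longrightarrow> g w = 0"
  shows "g a = 0"
proof -
  have "\<forall>\<^sub>F w in at a. g w = 0"
    unfolding eventually_at using assms(2) by (auto intro: exI[of _ 1])
  then have "(g \<longlongrightarrow> 0) (at a)"
    by (rule tendsto_eventually)
  moreover have "(g \<longlongrightarrow> g a) (at a)"
    using assms(1) unfolding isCont_def .
  ultimately show ?thesis
    using tendsto_unique[of "at a" g "g a" 0] by simp
qed

lemma form_eq_0I:
  assumes F: "is_form d F" and 0: "\<And>x y. x \<noteq> y \<Longrightarrow> F (x * y) (- (x + y)) 1 = 0"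
  shows "F z0 z1 z2 = 0"
proof -
  have A: "F u v 1 = 0" if "v\<^sup>2 \<noteq> 4 * u" for u v
  proof -
    define s where "s = csqrt (v\<^sup>2 - 4 * u)"
    have s: "s\<^sup>2 = v\<^sup>2 - 4 * u" by (simp add: s_def)
    then have "s \<noteq> 0" using that by auto
    define x y where "x = (s - v) / 2" and "y = (- s - v) / 2"
    have "x - y = s" by (simp add: x_def y_def field_simps)
    then have "x \<noteq> y" using \<open>s \<noteq> 0\<close> by auto
    then have "F (x * y) (- (x + y)) 1 = 0" by (rule 0)
    moreover have "x * y = (v\<^sup>2 - s\<^sup>2) / 4"
      by (simp add: x_def y_def field_simps power2_eq_square)
    then have "x * y = u" by (simp add: s)
    moreover have "- (x + y) = v" by (simp add: x_def y_def field_simps)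
    ultimately show ?thesis by simp
  qed
  have B: "F u v 1 = 0" for u v
  proof (cases "v\<^sup>2 = 4 * u")
    case True
    have "F w v 1 = 0" if "w \<noteq> u" for w using that True by (intro A) auto
    then show ?thesis
      using isCont_eq_0[where g = "\<lambda>w. F w v 1" and a = u] is_form_isCont(1)[OF F, where ?z0.0 = u and ?z1.0 = v and ?z2.0 = 1]
      by simp
  qed (rule A)
  have C: "F u v w = 0" if "w \<noteq> 0" for u v w
    using is_form_homogeneous[OF F, of w "u / w" "v / w" 1] that by (simp add: B)
  show ?thesis
  proof (cases "z2 = 0")
    case True
    then show ?thesis
      using isCont_eq_0[where g = "\<lambda>w. F z0 z1 w" and a = z2] is_form_isCont(2)[OF F, where ?z0.0 = z0 and ?z1.0 = z1 and ?z2.0 = z2] C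
      by simp
  qed (rule C)
qed

lemma poncelet_darboux_ex1:
  assumes n: "n \<ge> 1" and deg: "degree \<phi> \<le> n" "degree f \<le> n"
  shows "\<exists>!S. poncelet_darboux n \<phi> f S"
proof (rule ex_ex1I)
  define c where "c = (\<lambda>i j. coeff \<phi> i * coeff f j)"
  define T where "T = (\<lambda>i j x y z. c i j *
    (if j < i then x ^ j * z ^ (n - i) * complete_sym (i - j - 1) x y z
     else if i < j then (- 1) * (x ^ i * z ^ (n - j) * complete_sym (j - i - 1) x y z)
     else 0))"
  have T: "is_form (n - 1) (T i j)" if "i \<le> n" "j \<le> n" for i j
  proof -
    consider "j < i" | "i < j" | "i = j" by linarith
    then show ?thesis
    proof cases
      case 1
      then have "j + (n - i) + (i - j - 1) = n - 1" using that by simp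
      then show ?thesis
        using is_form_scale[OF is_form_mult_powers[OF is_form_complete_sym[of "i - j - 1"],
          of j "n - i"], of "c i j"] 1
        by (simp add: T_def)
    next
      case 2
      then have "i + (n - j) + (j - i - 1) = n - 1" using that by simp
      then show ?thesis
        using is_form_scale[OF is_form_mult_powers[OF is_form_complete_sym[of "j - i - 1"],
          of i "n - j"], of "- c i j"] 2
        by (simp add: T_def)
    next
      case 3
      then show ?thesis by (simp add: T_def is_form_zero)
    qed
  qed
  have val: "(x - y) * T i j (x * y) (- (x + y)) 1 = c i j * (x ^ i * y ^ j - y ^ i * x ^ j)"
    for i j x y
  proof -
    consider "j < i" | "i < j" | "i = j" by linarith
    then show ?thesis
    proof cases
      case 1
      then obtain k where i: "i = Suc (j + k)" using less_imp_Suc_add by blast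
      have "(x - y) * T i j (x * y) (- (x + y)) 1 =
        c i j * (x * y) ^ j * ((x - y) * complete_sym k (x * y) (- (x + y)) 1)"
        by (simp add: T_def i)
      then show ?thesis
        unfolding complete_sym_Darboux by (simp add: i power_add power_mult_distrib algebra_simps)
    next
      case 2
      then obtain k where j: "j = Suc (i + k)" using less_imp_Suc_add by blast
      have "(x - y) * T i j (x * y) (- (x + y)) 1 =
        - c i j * (x * y) ^ i * ((x - y) * complete_sym k (x * y) (- (x + y)) 1)"
        by (simp add: T_def j)
      then show ?thesis
        unfolding complete_sym_Darboux by (simp add: j power_add power_mult_distrib algebra_simps)
    qed (simp add: T_def)
  qed
  have P: "poly p x = (\<Sum>i\<le>n. coeff p i * x ^ i)" if "degree p \<le> n" for p :: "complex poly" and x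
    unfolding poly_altdef using that
    by (intro sum.mono_neutral_left) (auto simp: coeff_eq_0)
  have "poncelet_darboux n \<phi> f (\<lambda>x y z. \<Sum>i\<le>n. \<Sum>j\<le>n. T i j x y z)"
    unfolding poncelet_darboux_def
  proof (intro conjI allI)
    show "is_form (n - 1) (\<lambda>x y z. \<Sum>i\<le>n. \<Sum>j\<le>n. T i j x y z)"
      using T by (intro is_form_sum) auto
  next
    fix x y
    have "(x - y) * (\<Sum>i\<le>n. \<Sum>j\<le>n. T i j (x * y) (- (x + y)) 1) =
      (\<Sum>i\<le>n. \<Sum>j\<le>n. c i j * (x ^ i * y ^ j - y ^ i * x ^ j))"
      unfolding sum_distrib_left val ..
    also have "\<dots> = poly \<phi> x * poly f y - poly \<phi> y * poly f x"
      by (simp add: P[OF deg(1)] P[OF deg(2)] sum_product c_def algebra_simps sum_subtractf)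
    finally show "(x - y) * (\<Sum>i\<le>n. \<Sum>j\<le>n. T i j (x * y) (- (x + y)) 1) =
      poly \<phi> x * poly f y - poly \<phi> y * poly f x" .
  qed
  then show "\<exists>S. poncelet_darboux n \<phi> f S" by blast
next
  fix S S' assume S: "poncelet_darboux n \<phi> f S" "poncelet_darboux n \<phi> f S'"
  have "is_form (n - 1) (\<lambda>x y z. S x y z + (- 1) * S' x y z)"
    using S unfolding poncelet_darboux_def
    by (intro is_form_add is_form_scale[where s = "- 1" and F = S']) auto
  moreover have "S (x * y) (- (x + y)) 1 + (- 1) * S' (x * y) (- (x + y)) 1 = 0" if "x \<noteq> y" for x y
  proof -
    have "(x - y) * S (x * y) (- (x + y)) 1 = (x - y) * S' (x * y) (- (x + y)) 1"
      using S unfolding poncelet_darboux_def by simp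
    then show ?thesis using that by simp
  qed
  ultimately have "S x y z + (- 1) * S' x y z = 0" for x y z
    by (rule form_eq_0I[where F = "\<lambda>x y z. S x y z + (- 1) * S' x y z"])
  then show "S = S'" by (intro ext) simp
qed

end

theory Submission
  imports Defs "HOL-Complex_Analysis.Laurent_Convergence"
    "HOL-Computational_Algebra.Fundamental_Theorem_Algebra"
begin

text \<open>
  By Riemann-Hurwitz, \<open>F = \<phi> / f\<close> is ramified only over the four given values, so it satisfies
  \<open>dF\<^sup>2 / H(F) = dx\<^sup>2 / Q(x)\<close> with quartics \<open>H\<close> and \<open>Q\<close>, where the roots of \<open>Q\<close> are the
  simple points over these values. Let \<open>e\<close> be such a simple point and \<open>\<beta>\<close> a double point in the same fibre.
  Euler's equation \<open>dx\<^sup>2 / Q(x) = dy\<^sup>2 / Q(y)\<close> has a symmetric biquadratic integral curve through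
  \<open>(e, \<beta>)\<close>. Along it \<open>F(x)\<close> and \<open>F(y)\<close> solve the same differential equation with the same initial
  value, hence they agree. In the coordinates \<open>z\<close> the biquadratic curve is an irreducible conic, which
  therefore is a component of \<open>S\<close>. Different \<open>\<beta>\<close> give different conics, and what is left after dividing
  by all of them is a constant or a linear form.
\<close>

section \<open>Polynomials evaluated at power series\<close>

text \<open>Transversality enters only through the Wronskian: this is the restriction of
  \<open>S\<close> to \<open>conic_K\<close>, so its roots are simple and no pencil member has a
  root of multiplicity above two. Its degree is at most \<open>2 * n - 2\<close>, exactly the sum of
  the four given gcd degrees, which leaves no room for ramification elsewhere. The common initial
  value is a root of \<open>H\<close>, where the first order equation does not determine its
  solution. The base point is chosen accordingly: \<open>Q\<close> does not vanish at
  \<open>\<beta>\<close>, so \<open>y\<close> is a local parameter there, while \<open>x - e\<close>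
  vanishes to second order and thus matches the double point \<open>\<beta>\<close>. Both
  compositions are then non-constant series with the same start. The point \<open>e\<close> has to
  be finite, which requires a fibre of full degree with a simple point. At most one pencil member
  loses degree, so two candidate fibres suffice. Each biquadratic is the discriminant
  \<open>p1\<^sup>2 - 4 * p0 * p2\<close> of three independent linear forms, that is,
  \<open>conic_K\<close> in other coordinates. Its parametrization turns vanishing at infinitely
  many points into vanishing of a polynomial in one variable, and this yields divisibility of
  forms.\<close>

definition poly_fps :: "'a::comm_ring_1 poly \<Rightarrow> 'a fps \<Rightarrow> 'a fps" where
  "poly_fps p X = poly (map_poly fps_const p) X"

lemma poly_fps_0 [simp]: "poly_fps 0 X = 0"
  by (simp add: poly_fps_def)

lemma poly_fps_pCons [simp]: "poly_fps (pCons a p) X = fps_const a + X * poly_fps p X"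
  by (simp add: poly_fps_def map_poly_pCons)

lemma poly_fps_add [simp]: "poly_fps (p + q) X = poly_fps p X + poly_fps q X"
  by (induction p q rule: poly_induct2) (simp_all add: algebra_simps flip: fps_const_add)

lemma poly_fps_smult [simp]: "poly_fps (smult c p) X = fps_const c * poly_fps p X"
  by (induction p) (simp_all add: algebra_simps flip: fps_const_mult)

lemma poly_fps_1 [simp]: "poly_fps 1 X = 1"
  by (simp add: one_pCons)

lemma poly_fps_mult [simp]: "poly_fps (p * q) X = poly_fps p X * poly_fps q X"
  by (induction p) (simp_all add: algebra_simps)

lemma poly_fps_prod [simp]: "poly_fps (\<Prod>i\<in>I. p i) X = (\<Prod>i\<in>I. poly_fps (p i) X)"
  by (induction I rule: infinite_finite_induct) simp_all

lemma poly_fps_diff [simp]: "poly_fps (p - q) X = poly_fps p X - poly_fps q X"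
  using poly_fps_add[of "p - q" q X] by (simp del: poly_fps_add)

lemma poly_fps_nth_0 [simp]: "poly_fps p X $ 0 = poly p (X $ 0)"
  by (induction p) simp_all

lemma poly_fps_diff_dvd: "X - Y dvd poly_fps p X - poly_fps p Y"
proof (induction p)
  case (pCons a p)
  have "poly_fps (pCons a p) X - poly_fps (pCons a p) Y =
      (X - Y) * poly_fps p X + Y * (poly_fps p X - poly_fps p Y)"
    by (simp add: algebra_simps)
  then show ?case using pCons.IH by simp
qed simp

lemma fps_deriv_poly_fps:
  fixes X :: "'a::{idom} fps"
  shows "fps_deriv (poly_fps p X) = poly_fps (pderiv p) X * fps_deriv X"
  by (induction p) (simp_all add: pderiv_pCons algebra_simps)

text \<open>A non-constant series is transcendental over the constants: a relation, differentiated
  and divided by \<open>fps_deriv X\<close>, gives one of lower degree.\<close>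

lemma poly_fps_eq_0:
  fixes X :: "'a::{field_char_0} fps"
  assumes "poly_fps p X = 0" "fps_deriv X \<noteq> 0"
  shows "p = 0"
  using assms(1)
proof (induction "degree p" arbitrary: p rule: less_induct)
  case less
  have "poly_fps (pderiv p) X * fps_deriv X = 0"
    using fps_deriv_poly_fps[of p X] less.prems by simp
  then have 0: "poly_fps (pderiv p) X = 0" using assms(2) by simp
  show ?case
  proof (cases "degree p = 0")
    case True
    then obtain a where "p = [:a:]" by (meson degree_eq_zeroE)
    then show ?thesis using less.prems by simp
  next
    case False
    then have "pderiv p = 0" using less.hyps[OF _ 0] degree_pderiv[of p] by simp
    then show ?thesis using False pderiv_eq_0_iff[of p] by simp
  qed
qed

lemma has_fps_expansion_poly [fps_expansion_intros]:
  fixes x :: "complex \<Rightarrow> complex"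
  assumes "x has_fps_expansion X"
  shows "(\<lambda>t. poly p (x t)) has_fps_expansion poly_fps p X"
  by (induction p) (auto intro!: fps_expansion_intros assms)

lemma fps_mult_nth_lowest:
  fixes q u :: "'a::comm_ring_1 fps"
  assumes "\<And>j. j < n \<Longrightarrow> u $ j = 0"
  shows "(q * u) $ n = q $ 0 * u $ n"
proof -
  have "(q * u) $ n = (\<Sum>i=0..n. q $ i * u $ (n - i))" by (rule fps_mult_nth)
  also have "\<dots> = (\<Sum>i\<in>{0}. q $ i * u $ (n - i))"
    by (rule sum.mono_neutral_right) (use assms in auto)
  finally show ?thesis by simp
qed

text \<open>The equation itself is singular at the common initial value; differentiating it gives a
  regular equation of second order.\<close>

lemma fps_ode_unique:
  fixes q Z1 Z2 :: "complex fps"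
  assumes q: "q $ 0 \<noteq> 0"
    and ode: "q * (fps_deriv Z1)\<^sup>2 = poly_fps H Z1" "q * (fps_deriv Z2)\<^sup>2 = poly_fps H Z2"
    and nz: "fps_deriv Z1 \<noteq> 0" "fps_deriv Z2 \<noteq> 0"
    and init: "Z1 $ 0 = Z2 $ 0" "poly H (Z2 $ 0) = 0"
  shows "Z1 = Z2"
proof -
  \<comment> \<open>Cancelling \<open>fps_deriv Z\<close> is where the constant series is excluded;
    it solves the first order equation with the same initial value.\<close>
  have second: "2 * q * fps_deriv (fps_deriv Z) + fps_deriv q * fps_deriv Z = poly_fps (pderiv H) Z"
    if "q * (fps_deriv Z)\<^sup>2 = poly_fps H Z" "fps_deriv Z \<noteq> 0" for Z
  proof -
    have "fps_deriv (q * (fps_deriv Z)\<^sup>2) = fps_deriv (poly_fps H Z)"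
      using that(1) by simp
    then have "fps_deriv Z * (2 * q * fps_deriv (fps_deriv Z) + fps_deriv q * fps_deriv Z) =
        fps_deriv Z * poly_fps (pderiv H) Z"
      by (simp add: fps_deriv_poly_fps power2_eq_square algebra_simps)
    then show ?thesis using that(2) by simp
  qed
  have first: "Z $ 1 = 0" if "q * (fps_deriv Z)\<^sup>2 = poly_fps H Z" "poly H (Z $ 0) = 0"
    for Z :: "complex fps"
  proof -
    have "(q * (fps_deriv Z)\<^sup>2) $ 0 = 0" using that by simp
    then show ?thesis using q by (simp add: power2_eq_square)
  qed
  define U where "U = Z1 - Z2"
  obtain V where V: "poly_fps (pderiv H) Z1 - poly_fps (pderiv H) Z2 = U * V"
    using poly_fps_diff_dvd unfolding U_def dvd_def by blast
  have eq: "2 * q * fps_deriv (fps_deriv U) + fps_deriv q * fps_deriv U = U * V"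
    unfolding V[symmetric] second[OF ode(1) nz(1), symmetric] second[OF ode(2) nz(2), symmetric]
    by (simp add: U_def algebra_simps)
  have "U $ n = 0" for n
  proof (induction n rule: less_induct)
    case (less n)
    show ?case
    proof (cases "n < 2")
      case True
      then have "n = 0 \<or> n = 1" by auto
      then show ?thesis
        using init first[OF ode(1)] first[OF ode(2)] by (auto simp: U_def)
    next
      case False
      then obtain m where n: "n = Suc (Suc m)" by (metis add_2_eq_Suc le_Suc_ex not_less)
      \<comment> \<open>In coefficient \<open>m\<close> of \<open>eq\<close>, \<open>U $ n\<close>
        carries a nonzero multiple of \<open>q $ 0\<close>, and all other terms contain earlier
        coefficients of \<open>U\<close>.\<close>
      have "(fps_deriv q * fps_deriv U) $ m = fps_deriv q $ 0 * fps_deriv U $ m"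
        by (rule fps_mult_nth_lowest) (simp add: less n)
      moreover have "(V * U) $ m = V $ 0 * U $ m"
        by (rule fps_mult_nth_lowest) (simp add: less n)
      moreover have "(2 * q * fps_deriv (fps_deriv U)) $ m =
          (2 * q) $ 0 * fps_deriv (fps_deriv U) $ m"
        by (rule fps_mult_nth_lowest) (simp add: less n)
      moreover have "U $ Suc m = 0" "U $ m = 0" using less n by simp_all
      ultimately have "(2 * q) $ 0 * fps_deriv (fps_deriv U) $ m = 0"
        using arg_cong[OF eq, of "\<lambda>F. F $ m"] by (simp add: mult.commute)
      then show ?thesis using q n by (simp add: of_nat_neq_0 del: of_nat_Suc)
    qed
  qed
  then have "U = 0" by (simp add: fps_eq_iff)
  then show ?thesis by (simp add: U_def)
qed

section \<open>Euler's differential equation\<close>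

abbreviation wronskian :: "complex poly \<Rightarrow> complex poly \<Rightarrow> complex poly" where
  "wronskian \<phi> f \<equiv> pderiv \<phi> * f - \<phi> * pderiv f"

text \<open>Differentiating \<open>P = Z * F\<close> gives \<open>Z' F\<^sup>2 = W(X) X'\<close>;
  its square contains \<open>W\<^sup>2 * Q\<close>, which is the product of the pencil up to a
  constant. The series \<open>q\<close> is independent of \<open>X\<close> because both coordinates
  of the integral curve are treated with the same coefficient.\<close>

lemma fps_ode_quotient:
  fixes \<phi> f Q W :: "complex poly" and X q Z :: "complex fps"
  defines "W \<equiv> wronskian \<phi> f"
  assumes T: "card T = 4" and X: "q * (fps_deriv X)\<^sup>2 = poly_fps Q X" and f: "poly f (X $ 0) \<noteq> 0"
    and W: "W\<^sup>2 * Q = smult \<kappa> (\<Prod>t\<in>T. pencil \<phi> f t)"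
    and Z: "Z = poly_fps \<phi> X * inverse (poly_fps f X)"
  shows "q * (fps_deriv Z)\<^sup>2 =
      poly_fps (smult \<kappa> (\<Prod>t\<in>T. [:t, 1:])) Z"
    and "W \<noteq> 0 \<Longrightarrow> fps_deriv X \<noteq> 0 \<Longrightarrow> fps_deriv Z \<noteq> 0"
proof -
  define F P where "F = poly_fps f X" and "P = poly_fps \<phi> X"
  have F0: "F $ 0 \<noteq> 0" using f by (simp add: F_def)
  then have "F \<noteq> 0" by auto
  have PZ: "P = Z * F"
    using inverse_mult_eq_1[OF F0] by (simp add: Z F_def[symmetric] P_def[symmetric] mult.assoc)
  have "fps_deriv P = fps_deriv Z * F + Z * fps_deriv F"
    by (simp add: PZ)
  then have "fps_deriv Z * F\<^sup>2 = fps_deriv P * F - P * fps_deriv F"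
    by (simp add: PZ power2_eq_square algebra_simps)
  also have "\<dots> = poly_fps W X * fps_deriv X"
    by (simp add: P_def F_def W_def fps_deriv_poly_fps algebra_simps)
  finally have Z': "fps_deriv Z * F\<^sup>2 = poly_fps W X * fps_deriv X" .
  have "(F\<^sup>2)\<^sup>2 * (q * (fps_deriv Z)\<^sup>2) = q * (fps_deriv Z * F\<^sup>2)\<^sup>2"
    by (simp add: power_mult_distrib mult_ac)
  also have "\<dots> = (poly_fps W X)\<^sup>2 * (q * (fps_deriv X)\<^sup>2)"
    unfolding Z' by (simp add: power_mult_distrib mult_ac)
  also have "\<dots> = poly_fps (W\<^sup>2 * Q) X"
    unfolding X by (simp add: power2_eq_square)
  also have "\<dots> = (F\<^sup>2)\<^sup>2 * poly_fps (smult \<kappa> (\<Prod>t\<in>T. [:t, 1:])) Z"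
  proof -
    \<comment> \<open>Each of the four pencil members contributes one \<open>F\<close>, so
      \<open>F ^ 4\<close> cancels exactly the denominator of
      \<open>(fps_deriv Z)\<^sup>2\<close>.\<close>
    have "poly_fps (pencil \<phi> f t) X = F * poly_fps [:t, 1:] Z" for t
      by (simp add: pencil_def PZ algebra_simps flip: P_def F_def)
    then have "(\<Prod>t\<in>T. poly_fps (pencil \<phi> f t) X) = F ^ 4 * (\<Prod>t\<in>T. poly_fps [:t, 1:] Z)"
      using T by (simp only: prod.distrib prod_constant)
    then show ?thesis
      unfolding W by (simp add: mult_ac flip: power_mult)
  qed
  finally show "q * (fps_deriv Z)\<^sup>2 =
      poly_fps (smult \<kappa> (\<Prod>t\<in>T. [:t, 1:])) Z"
    using \<open>F \<noteq> 0\<close> by simp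
  show "fps_deriv Z \<noteq> 0" if "W \<noteq> 0" "fps_deriv X \<noteq> 0"
    using Z' poly_fps_eq_0[of W X] that by (metis mult_eq_0_iff)
qed

text \<open>In the coordinates \<open>1 / x\<close>, \<open>1 / y\<close>, \<open>1 / b\<close> this is the condition that three points of the cubic
  \<open>w\<^sup>2 = A s\<^sup>3 + B s\<^sup>2 + C s + D\<close> with these values of \<open>s\<close> lie on a line. It is the integral curve
  through \<open>(0, b)\<close> for \<open>Q(x) = A x + B x\<^sup>2 + C x\<^sup>3 + D x\<^sup>4\<close>.\<close>

definition euler_biquadratic :: "'a::comm_ring_1 \<Rightarrow> 'a \<Rightarrow> 'a \<Rightarrow> 'a \<Rightarrow> 'a \<Rightarrow> 'a \<Rightarrow> 'a \<Rightarrow> 'a" where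
  "euler_biquadratic A B C D b x y = (C * b * x * y - A * (x + y + b))\<^sup>2 -
     4 * (A * x * y + A * b * (x + y) + B * b * x * y) * (A + D * b * x * y)"

text \<open>As a quadratic polynomial in \<open>x\<close>, the biquadratic has discriminant
  \<open>16 * A\<^sup>2 * q b * q y\<close>, and on the curve this equals the square of the partial
  derivative \<open>p\<close>. By symmetry the other partial derivative has square
  \<open>16 * A\<^sup>2 * q b * q x\<close>; the quotient is the squared slope.\<close>

lemma euler_biquadratic_ode:
  fixes A B C D b X Y :: "complex fps"
  defines "q \<equiv> \<lambda>x. x * (A + x * (B + x * (C + x * D)))"
  assumes G: "euler_biquadratic A B C D b X Y = 0"
    and const: "fps_deriv A = 0" "fps_deriv B = 0" "fps_deriv C = 0" "fps_deriv D = 0" "fps_deriv b = 0"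
    and Y: "fps_deriv Y = 1" and nz: "A \<noteq> 0" "q b \<noteq> 0"
  shows "q Y * (fps_deriv X)\<^sup>2 = q X"
proof -
  define a2 where "a2 = (\<lambda>y. (C * b * y - A)\<^sup>2 - 4 * (A * y + A * b + B * b * y) * D * b * y)"
  define a1 where "a1 = (\<lambda>y. - 2 * A * (C * b * y - A) * (y + b)
      - 4 * A * (A * y + A * b + B * b * y) - 4 * A * D * b\<^sup>2 * y\<^sup>2)"
  define p where "p = (\<lambda>x y. 2 * a2 y * x + a1 y)"
  have p2: "(p x y)\<^sup>2 = 16 * A\<^sup>2 * q b * q y + 4 * a2 y * euler_biquadratic A B C D b x y" for x y
    unfolding p_def a1_def a2_def q_def euler_biquadratic_def power2_eq_square by algebra
  have sym: "euler_biquadratic A B C D b Y X = euler_biquadratic A B C D b X Y"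
    by (simp add: euler_biquadratic_def algebra_simps)
  have "fps_deriv (euler_biquadratic A B C D b X Y) = p X Y * fps_deriv X + p Y X"
    unfolding euler_biquadratic_def p_def a1_def a2_def power2_eq_square
    by (simp add: const Y algebra_simps)
  then have "p X Y * fps_deriv X = - p Y X"
    using G by (simp add: eq_neg_iff_add_eq_0)
  then have "(p X Y * fps_deriv X)\<^sup>2 = (p Y X)\<^sup>2" by simp
  then have "16 * A\<^sup>2 * q b * (q Y * (fps_deriv X)\<^sup>2) = 16 * A\<^sup>2 * q b * q X"
    by (simp add: power_mult_distrib p2 sym G mult_ac)
  then show ?thesis using nz by simp
qed

text \<open>The branch through \<open>(0, b)\<close> comes from the quadratic formula, whose
  discriminant is a multiple of \<open>poly Q y\<close> and hence nonzero at
  \<open>y = b\<close>.\<close>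

lemma euler_biquadratic_germ:
  fixes A B C D b :: complex
  defines "Q \<equiv> [:0, A, B, C, D:]"
  assumes A: "A \<noteq> 0" and b: "b \<noteq> 0" and Qb: "poly Q b \<noteq> 0"
  obtains x X where "x has_fps_expansion X" "x 0 = 0"
    "\<forall>\<^sub>F t in nhds 0. euler_biquadratic A B C D b (x t) (b + t) = 0"
    "poly_fps Q (fps_const b + fps_X) * (fps_deriv X)\<^sup>2 = poly_fps Q X" "fps_deriv X \<noteq> 0"
proof -
  define a0 where "a0 = (\<lambda>y. A\<^sup>2 * (y - b)\<^sup>2)"
  define a1 where "a1 = (\<lambda>y. - 2 * A * (C * b * y - A) * (y + b)
      - 4 * A * (A * y + A * b + B * b * y) - 4 * A * D * b\<^sup>2 * y\<^sup>2)"
  define a2 where "a2 = (\<lambda>y. (C * b * y - A)\<^sup>2 - 4 * (A * y + A * b + B * b * y) * D * b * y)"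
  have G: "euler_biquadratic A B C D b x y = a2 y * x\<^sup>2 + a1 y * x + a0 y" for x y
    unfolding a0_def a1_def a2_def euler_biquadratic_def power2_eq_square by algebra
  define d where "d = (\<lambda>y. 16 * A\<^sup>2 * poly Q b * poly Q y)"
  have disc: "(a1 y)\<^sup>2 = d y + 4 * a0 y * a2 y" for y
    unfolding a0_def a1_def a2_def d_def Q_def power2_eq_square by simp algebra
  have a0b: "a0 b = 0" by (simp add: a0_def)
  define r where "r = a1 b"
  have r2: "r\<^sup>2 = d b" using disc[of b] by (simp add: r_def a0b)
  have "d b \<noteq> 0" using A Qb by (simp add: d_def)
  then have r: "r \<noteq> 0" using r2 by auto
  \<comment> \<open>Dividing by \<open>r\<^sup>2\<close> moves the argument of \<open>csqrt\<close>
    to 1 at \<open>t = 0\<close>, away from the branch cut, and selects the square root with value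
    \<open>r\<close>.\<close>
  define R where "R = (\<lambda>t. r * csqrt (d (b + t) / r\<^sup>2))"
  have R0: "R 0 = r" using r by (simp add: R_def flip: r2)
  have R2: "(R t)\<^sup>2 = d (b + t)" for t
    using r by (simp add: R_def power_mult_distrib)
  \<comment> \<open>This version of the quadratic formula avoids dividing by \<open>a2\<close>,
    which may vanish at \<open>b\<close>; its denominator tends to \<open>2 * r\<close>.\<close>
  define x where "x = (\<lambda>t. - 2 * a0 (b + t) / (a1 (b + t) + R t))"
  have an_R: "R analytic_on {0}"
    unfolding R_def using r \<open>d b \<noteq> 0\<close>
    by (intro analytic_on_csqrt' analytic_intros) (auto simp: d_def Q_def r2 intro!: analytic_intros)
  have an_a: "(\<lambda>t. a0 (b + t)) analytic_on {0}" "(\<lambda>t. a1 (b + t)) analytic_on {0}"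
    unfolding a0_def a1_def by (intro analytic_intros)+
  have "x analytic_on {0}"
    unfolding x_def using r by (intro analytic_intros an_R an_a) (auto simp: R0 r_def)
  then obtain X where X: "x has_fps_expansion X"
    using analytic_at_imp_has_fps_expansion_0 by blast
  have x0: "x 0 = 0" by (simp add: x_def a0b)
  have "isCont (\<lambda>t. a1 (b + t) + R t) 0"
    using an_R an_a(2) by (intro continuous_intros analytic_at_imp_isCont)
  then have "\<forall>\<^sub>F t in nhds 0. a1 (b + t) + R t \<noteq> 0"
    using r by (intro tendsto_imp_eventually_ne[of _ "a1 (b + 0) + R 0"])
      (auto simp: isCont_def R0 r_def tendsto_nhds_iff)
  then have ev: "\<forall>\<^sub>F t in nhds 0. euler_biquadratic A B C D b (x t) (b + t) = 0"
  proof eventually_elim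
    case (elim t)
    define s where "s = a1 (b + t) + R t"
    have xs: "x t * s = - 2 * a0 (b + t)" using elim by (simp add: x_def s_def)
    have "(s - a1 (b + t))\<^sup>2 = (a1 (b + t))\<^sup>2 - 4 * a0 (b + t) * a2 (b + t)"
      unfolding disc by (simp add: s_def R2)
    then have "s\<^sup>2 * euler_biquadratic A B C D b (x t) (b + t) = 0"
      unfolding G using xs by algebra
    then show ?case using elim by (simp add: s_def)
  qed
  define Y where "Y = fps_const b + fps_X"
  have Y: "(\<lambda>t. b + t) has_fps_expansion Y"
    unfolding Y_def by (intro fps_expansion_intros)
  have "(\<lambda>t. euler_biquadratic A B C D b (x t) (b + t)) has_fps_expansion
      euler_biquadratic (fps_const A) (fps_const B) (fps_const C) (fps_const D) (fps_const b) X Y"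
    unfolding euler_biquadratic_def power2_eq_square by (intro fps_expansion_intros X Y)
  moreover have "(\<lambda>t. euler_biquadratic A B C D b (x t) (b + t)) has_fps_expansion 0"
    using ev by (simp add: has_fps_expansion_0_iff)
  ultimately have GX:
    "euler_biquadratic (fps_const A) (fps_const B) (fps_const C) (fps_const D) (fps_const b) X Y = 0"
    by (rule fps_expansion_unique_complex)
  have "poly_fps Q (fps_const b) = fps_const (poly Q b)"
    by (simp add: Q_def)
  then have Qb': "poly_fps Q (fps_const b) \<noteq> 0" using Qb by simp
  have "poly_fps Q Y * (fps_deriv X)\<^sup>2 = poly_fps Q X"
    using euler_biquadratic_ode[OF GX] A Qb' by (simp add: Q_def Y_def)
  moreover have "fps_deriv X \<noteq> 0"
  proof
    assume "fps_deriv X = 0"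
    moreover have "X $ 0 = 0"
      using has_fps_expansion_imp_0_eq_fps_nth_0[OF X] x0 by simp
    ultimately have "X = 0" by (simp add: fps_deriv_eq_0_iff)
    then have "(fps_const A)\<^sup>2 * fps_X\<^sup>2 = 0"
      using GX by (simp add: euler_biquadratic_def Y_def power2_eq_square algebra_simps)
    then show False using A by simp
  qed
  ultimately show ?thesis
    using X x0 ev unfolding Y_def by (intro that)
qed

text \<open>Equality of the two series for \<open>\<phi> / f\<close> is an identity of germs, hence
  holds for all \<open>y\<close> in a disc around \<open>b\<close>. The condition
  \<open>x \<noteq> y\<close> later permits cancelling \<open>x - y\<close> in the equation of the
  Poncelet-Darboux curve.\<close>

lemma infinite_euler_biquadratic_points:
  fixes A B C D b :: complex and \<phi> f :: "complex poly"
  defines "Q \<equiv> [:0, A, B, C, D:]" and "W \<equiv> wronskian \<phi> f"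
  assumes A: "A \<noteq> 0" and b: "b \<noteq> 0" and Qb: "poly Q b \<noteq> 0" and W0: "W \<noteq> 0"
    and T: "card T = 4" "t1 \<in> T" and W: "W\<^sup>2 * Q = smult \<kappa> (\<Prod>t\<in>T. pencil \<phi> f t)"
    and f: "poly f 0 \<noteq> 0" "poly f b \<noteq> 0"
    and fibre: "poly (pencil \<phi> f t1) 0 = 0" "poly (pencil \<phi> f t1) b = 0"
  shows "infinite {y. \<exists>x. x \<noteq> y \<and> A + D * b * x * y \<noteq> 0 \<and>
      euler_biquadratic A B C D b x y = 0 \<and> poly \<phi> x * poly f y = poly \<phi> y * poly f x}"
    (is "infinite ?S")
proof -
  obtain x X where X: "x has_fps_expansion X" "x 0 = 0"
    and G: "\<forall>\<^sub>F t in nhds 0. euler_biquadratic A B C D b (x t) (b + t) = 0"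
    and ode: "poly_fps Q (fps_const b + fps_X) * (fps_deriv X)\<^sup>2 = poly_fps Q X"
    and nz: "fps_deriv X \<noteq> 0"
    using euler_biquadratic_germ[OF A b, of B C D] Qb unfolding Q_def by blast
  define Y where "Y = fps_const b + fps_X"
  have Y: "(\<lambda>t. b + t) has_fps_expansion Y"
    unfolding Y_def by (intro fps_expansion_intros)
  have Y': "fps_deriv Y = 1" "Y $ 0 = b" by (simp_all add: Y_def)
  have X0: "X $ 0 = 0" using has_fps_expansion_imp_0_eq_fps_nth_0[OF X(1)] X(2) by simp
  define H where "H = smult \<kappa> (\<Prod>t\<in>T. [:t, 1:])"
  define Z1 where "Z1 = poly_fps \<phi> X * inverse (poly_fps f X)"
  define Z2 where "Z2 = poly_fps \<phi> Y * inverse (poly_fps f Y)"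
  \<comment> \<open>Both are series in \<open>y - b\<close>. Since \<open>fps_deriv Y = 1\<close>,
    the coefficient \<open>poly_fps Q Y\<close> serves for \<open>X\<close> and for \<open>Y\<close>
    alike.\<close>
  have "Z1 = Z2"
  proof (rule fps_ode_unique)
    show "poly_fps Q Y $ 0 \<noteq> 0" using Qb by (simp add: Y')
    show "poly_fps Q Y * (fps_deriv Z1)\<^sup>2 = poly_fps H Z1"
      unfolding H_def using ode W f(1)
      by (intro fps_ode_quotient(1)[OF T(1), of _ _ Q f \<phi>]) (simp_all add: Y_def Z1_def W_def X0)
    show "poly_fps Q Y * (fps_deriv Z2)\<^sup>2 = poly_fps H Z2"
      unfolding H_def using W f(2)
      by (intro fps_ode_quotient(1)[OF T(1), of _ _ Q f \<phi>]) (simp_all add: Z2_def W_def Y')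
    show "fps_deriv Z1 \<noteq> 0"
      using fps_ode_quotient(2)[OF T(1) ode _ W[unfolded W_def] Z1_def] f(1) W0 nz
      by (simp add: X0 W_def)
    show "fps_deriv Z2 \<noteq> 0"
      using fps_ode_quotient(2)[OF T(1) _ _ W[unfolded W_def] Z2_def, of "poly_fps Q Y"] f(2) W0
      by (simp add: Y' W_def)
    \<comment> \<open>Both \<open>0\<close> and \<open>b\<close> lie in the fibre of
      \<open>t1\<close>, where \<open>\<phi> / f\<close> takes the value \<open>- t1\<close>, the
      root of the factor \<open>[:t1, 1:]\<close> of \<open>H\<close>.\<close>
    have v: "Z1 $ 0 = - t1" "Z2 $ 0 = - t1"
      using f fibre by (simp_all add: Z1_def Z2_def X0 Y' pencil_def field_simps eq_neg_iff_add_eq_0)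
    then show "Z1 $ 0 = Z2 $ 0" by simp
    show "poly H (Z2 $ 0) = 0"
      unfolding H_def v poly_smult poly_prod using T(2) card_ge_0_finite[of T] T(1)
      by (auto intro!: prod_zero)
  qed
  have "poly_fps f X * inverse (poly_fps f X) = 1" "poly_fps f Y * inverse (poly_fps f Y) = 1"
    using f by (intro inverse_mult_eq_1'; simp add: X0 Y')+
  then have eq: "poly_fps \<phi> X * poly_fps f Y = poly_fps \<phi> Y * poly_fps f X"
    using \<open>Z1 = Z2\<close> unfolding Z1_def Z2_def by algebra
  have "(\<lambda>t. poly \<phi> (x t) * poly f (b + t) - poly \<phi> (b + t) * poly f (x t)) has_fps_expansion
      poly_fps \<phi> X * poly_fps f Y - poly_fps \<phi> Y * poly_fps f X"
    by (intro fps_expansion_intros X Y)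
  then have F: "\<forall>\<^sub>F t in nhds 0. poly \<phi> (x t) * poly f (b + t) - poly \<phi> (b + t) * poly f (x t) = 0"
    unfolding eq by (simp add: has_fps_expansion_0_iff)
  have cont: "isCont x 0" using has_fps_expansion_imp_continuous[OF X(1), of UNIV] by simp
  have lim: "(x \<longlongrightarrow> 0) (nhds 0)" "((\<lambda>t. t) \<longlongrightarrow> (0::complex)) (nhds 0)"
    using cont X(2) by (auto simp: isCont_def tendsto_nhds_iff intro: filterlim_ident)
  have "((\<lambda>t. x t - (b + t)) \<longlongrightarrow> 0 - (b + 0)) (nhds 0)"
    by (intro tendsto_intros lim)
  then have "\<forall>\<^sub>F t in nhds 0. x t - (b + t) \<noteq> 0"
    by (rule tendsto_imp_eventually_ne) (use b in simp)
  moreover have "((\<lambda>t. A + D * b * x t * (b + t)) \<longlongrightarrow> A + D * b * 0 * (b + 0)) (nhds 0)"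
    by (intro tendsto_intros lim)
  then have "\<forall>\<^sub>F t in nhds 0. A + D * b * x t * (b + t) \<noteq> 0"
    by (rule tendsto_imp_eventually_ne) (use A in simp)
  ultimately have "\<forall>\<^sub>F t in nhds 0. b + t \<in> ?S"
    using F G by eventually_elim auto
  then obtain \<epsilon> where \<epsilon>: "\<epsilon> > 0" "\<And>t. dist t 0 < \<epsilon> \<Longrightarrow> b + t \<in> ?S"
    unfolding eventually_nhds_metric by blast
  have "ball b \<epsilon> \<subseteq> ?S"
  proof
    fix y assume "y \<in> ball b \<epsilon>"
    then have "dist (y - b) 0 < \<epsilon>" by (simp add: dist_norm norm_minus_commute)
    from \<epsilon>(2)[OF this] show "y \<in> ?S" by simp
  qed
  moreover have "infinite (ball b \<epsilon>)"
    using uncountable_ball[OF \<epsilon>(1), of b] countable_finite by blast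
  ultimately show ?thesis using finite_subset by blast
qed

section \<open>Ternary forms and conics\<close>

lemma is_form_const: "is_form 0 (\<lambda>_ _ _. c)"
  unfolding is_form_def by (rule exI[of _ "\<lambda>_ _. c"]) simp

lemma is_form_0_const: "is_form 0 F \<Longrightarrow> F x y z = F x' y' z'"
  unfolding is_form_def by auto

lemma is_form_mult_monomial:
  assumes "is_form d F"
  shows "is_form (i + j + k + d) (\<lambda>x y z. x ^ i * y ^ j * z ^ k * F x y z)"
proof (induction j)
  case 0
  show ?case using is_form_mult_powers[OF assms] by simp
next
  case (Suc j)
  show ?case using is_form_mult_z1[OF Suc.IH] by (simp add: mult_ac)
qed

lemma is_form_monomial: "is_form (i + j + k) (\<lambda>x y z. x ^ i * y ^ j * z ^ k)"
  using is_form_mult_monomial[OF is_form_const[of 1]] by simp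

lemma is_form_mult:
  assumes "is_form a A" "is_form b B"
  shows "is_form (a + b) (\<lambda>x y z. A x y z * B x y z)"
proof -
  obtain c where c:
    "\<And>x y z. A x y z = (\<Sum>i\<le>a. \<Sum>j\<le>a - i. c i j * x ^ i * y ^ j * z ^ (a - i - j))"
    using assms(1) unfolding is_form_def by blast
  have "is_form (a + b) (\<lambda>x y z. \<Sum>i\<le>a. \<Sum>j\<le>a - i.
      c i j * (x ^ i * y ^ j * z ^ (a - i - j) * B x y z))"
  proof (intro is_form_sum is_form_scale)
    fix i j assume "i \<in> {..a}" "j \<in> {..a - i}"
    then have "i + j + (a - i - j) + b = a + b" by auto
    then show "is_form (a + b) (\<lambda>x y z. x ^ i * y ^ j * z ^ (a - i - j) * B x y z)"
      using is_form_mult_monomial[OF assms(2), of i j "a - i - j"] by simp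
  qed
  then show ?thesis
    unfolding c sum_distrib_right by (simp add: mult.assoc)
qed

lemma is_form_power: "is_form d F \<Longrightarrow> is_form (n * d) (\<lambda>x y z. F x y z ^ n)"
  by (induction n) (auto intro: is_form_const is_form_mult)

lemma is_form_linear: "is_form 1 (\<lambda>x y z. a * x + b * y + c * z)"
proof -
  have "is_form 1 (\<lambda>x y z. a * (x * 1) + b * (y * 1) + c * (z * 1))"
    unfolding One_nat_def
    by (intro is_form_add is_form_scale is_form_mult_z0 is_form_mult_z1 is_form_mult_z2 is_form_const)
  then show ?thesis by simp
qed

lemma is_form_compose:
  assumes F: "is_form d F" and p: "is_form 1 p0" "is_form 1 p1" "is_form 1 p2"
  shows "is_form d (\<lambda>x y z. F (p0 x y z) (p1 x y z) (p2 x y z))"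
proof -
  obtain c where c:
    "\<And>x y z. F x y z = (\<Sum>i\<le>d. \<Sum>j\<le>d - i. c i j * x ^ i * y ^ j * z ^ (d - i - j))"
    using F unfolding is_form_def by blast
  have "is_form d (\<lambda>x y z. \<Sum>i\<le>d. \<Sum>j\<le>d - i.
      c i j * (p0 x y z ^ i * p1 x y z ^ j * p2 x y z ^ (d - i - j)))"
  proof (intro is_form_sum is_form_scale)
    fix i j assume "i \<in> {..d}" "j \<in> {..d - i}"
    then have "i * 1 + j * 1 + (d - i - j) * 1 = d" by auto
    then show "is_form d (\<lambda>x y z. p0 x y z ^ i * p1 x y z ^ j * p2 x y z ^ (d - i - j))"
      using is_form_mult[OF is_form_mult[OF is_form_power[OF p(1), of i] is_form_power[OF p(2), of j]]
          is_form_power[OF p(3), of "d - i - j"]] by simp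
  qed
  then show ?thesis
    unfolding c by (simp add: mult.assoc)
qed

lemma is_form_compose_poly:
  assumes "is_form d F"
  obtains p where "\<And>s. F (poly a s) (poly b s) (poly c s) = poly p s"
proof -
  obtain k where k:
    "\<And>x y z. F x y z = (\<Sum>i\<le>d. \<Sum>j\<le>d - i. k i j * x ^ i * y ^ j * z ^ (d - i - j))"
    using assms unfolding is_form_def by blast
  show ?thesis
    by (rule that[of "\<Sum>i\<le>d. \<Sum>j\<le>d - i. smult (k i j) (a ^ i * b ^ j * c ^ (d - i - j))"])
      (simp add: k poly_sum mult.assoc)
qed

lemma is_form_conic_K: "is_form 2 conic_K"
proof -
  have "conic_K = (\<lambda>x y z. x ^ 0 * y ^ 2 * z ^ 0 + (- 4) * (x ^ 1 * y ^ 0 * z ^ 1))"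
    by (intro ext) (simp add: conic_K_def)
  moreover have "is_form 2 (\<lambda>x y z. x ^ 0 * y ^ 2 * z ^ 0 + (- 4) * (x ^ 1 * y ^ 0 * z ^ 1))"
    using is_form_monomial[of 0 2 0] is_form_monomial[of 1 0 1]
    by (intro is_form_add is_form_scale) (simp_all add: numeral_2_eq_2)
  ultimately show ?thesis by metis
qed

text \<open>Modulo \<open>conic_K\<close> each \<open>y\<^sup>2\<close> may be replaced by
  \<open>4 * x * z\<close>. In degree below 2 truncated subtraction would admit a constant quotient,
  so its vanishing is a separate clause.\<close>

lemma monomial_mod_conic_K:
  "\<exists>T. is_form (i + j + k - 2) T \<and> (i + j + k < 2 \<longrightarrow> T = (\<lambda>_ _ _. 0)) \<and>
     (\<forall>x y z. x ^ i * y ^ j * z ^ k = conic_K x y z * T x y z +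
        4 ^ (j div 2) * x ^ (i + j div 2) * y ^ (j mod 2) * z ^ (k + j div 2))"
proof (induction j arbitrary: i k rule: less_induct)
  case (less j)
  show ?case
  proof (cases "j < 2")
    case True
    then show ?thesis
      by (intro exI[of _ "\<lambda>_ _ _. 0"]) (auto simp: is_form_zero)
  next
    case False
    then obtain l where j: "j = Suc (Suc l)" by (metis add_2_eq_Suc le_Suc_ex not_less)
    obtain T where T: "is_form (Suc i + l + Suc k - 2) T"
      "\<And>x y z. x ^ Suc i * y ^ l * z ^ Suc k = conic_K x y z * T x y z +
        4 ^ (l div 2) * x ^ (Suc i + l div 2) * y ^ (l mod 2) * z ^ (Suc k + l div 2)"
      using less.IH[of l "Suc i" "Suc k"] j by (metis lessI less_SucI)
    have "x ^ i * y ^ j * z ^ k = conic_K x y z * (x ^ i * y ^ l * z ^ k + 4 * T x y z) +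
        4 ^ (j div 2) * x ^ (i + j div 2) * y ^ (j mod 2) * z ^ (k + j div 2)" for x y z
    proof -
      have "x ^ i * y ^ j * z ^ k =
          conic_K x y z * (x ^ i * y ^ l * z ^ k) + 4 * (x ^ Suc i * y ^ l * z ^ Suc k)"
        by (simp add: j conic_K_def power2_eq_square algebra_simps)
      moreover have "4 ^ (j div 2) * x ^ (i + j div 2) * y ^ (j mod 2) * z ^ (k + j div 2) =
          4 * (4 ^ (l div 2) * x ^ (Suc i + l div 2) * y ^ (l mod 2) * z ^ (Suc k + l div 2))"
        by (simp add: j)
      ultimately show ?thesis
        unfolding T(2)[of x y z] by (simp only: distrib_left mult_ac add_ac)
    qed
    moreover have "is_form (i + j + k - 2) (\<lambda>x y z. x ^ i * y ^ l * z ^ k + 4 * T x y z)"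
      using T(1) is_form_monomial[of i l k] by (intro is_form_add is_form_scale) (simp_all add: j)
    ultimately show ?thesis using j by (intro exI conjI) auto
  qed
qed

text \<open>Modulo \<open>conic_K\<close> a form reduces to a combination of the monomials below, one for each weight
  \<open>m = 2 * i + j\<close>, and these restrict to distinct powers of the parameter of \<open>conic_K\<close>.\<close>

lemma conic_K_dvd_form:
  assumes F: "is_form d F" and inf: "infinite {s. F (s\<^sup>2) (- 2 * s) 1 = 0}"
  shows "\<exists>T. is_form (d - 2) T \<and> (d < 2 \<longrightarrow> T = (\<lambda>_ _ _. 0)) \<and>
     (\<forall>x y z. F x y z = conic_K x y z * T x y z)"
proof -
  obtain c where c:
    "\<And>x y z. F x y z = (\<Sum>i\<le>d. \<Sum>j\<le>d - i. c i j * x ^ i * y ^ j * z ^ (d - i - j))"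
    using F unfolding is_form_def by blast
  define P where "P = (SIGMA i:{..d}. {..d - i})"
  have finP: "finite P" by (simp add: P_def)
  have "\<forall>i j. \<exists>T. is_form (i + j + (d - i - j) - 2) T \<and>
      (i + j + (d - i - j) < 2 \<longrightarrow> T = (\<lambda>_ _ _. 0)) \<and>
      (\<forall>x y z. x ^ i * y ^ j * z ^ (d - i - j) = conic_K x y z * T x y z +
        4 ^ (j div 2) * x ^ (i + j div 2) * y ^ (j mod 2) * z ^ (d - i - j + j div 2))"
    using monomial_mod_conic_K by blast
  then obtain T where T: "\<And>i j. is_form (i + j + (d - i - j) - 2) (T i j)"
      "\<And>i j. i + j + (d - i - j) < 2 \<Longrightarrow> T i j = (\<lambda>_ _ _. 0)"
      "\<And>i j x y z. x ^ i * y ^ j * z ^ (d - i - j) = conic_K x y z * T i j x y z +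
        4 ^ (j div 2) * x ^ (i + j div 2) * y ^ (j mod 2) * z ^ (d - i - j + j div 2)"
    by metis
  define U where "U = (\<lambda>x y z. \<Sum>i\<le>d. \<Sum>j\<le>d - i. c i j * T i j x y z)"
  define e where "e = (\<lambda>m. \<Sum>(i, j)\<in>{p \<in> P. 2 * fst p + snd p = m}. c i j * 4 ^ (j div 2))"
  define M where "M = (\<lambda>m (x::complex) y z. x ^ (m div 2) * y ^ (m mod 2) * z ^ (d - m div 2 - m mod 2))"
  have mono: "x ^ (i + j div 2) * y ^ (j mod 2) * z ^ (d - i - j + j div 2) = M (2 * i + j) x y z"
    if "(i, j) \<in> P" for i j x y z
  proof -
    have "i \<le> d" "j \<le> d - i" using that by (auto simp: P_def)
    then have "d - i - j + h = d - (i + h) - p" if "j = h + h + p" for h p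
      using that by simp
    moreover have "j = j div 2 + j div 2 + j mod 2"
      using mult_div_mod_eq[of 2 j] by (simp only: mult_2)
    ultimately have "d - i - j + j div 2 = d - (i + j div 2) - j mod 2" by blast
    then show ?thesis by (simp add: M_def)
  qed
  have F_eq: "F x y z = conic_K x y z * U x y z + (\<Sum>m\<le>2 * d. e m * M m x y z)" for x y z
  proof -
    have "F x y z = (\<Sum>(i, j)\<in>P. c i j * (x ^ i * y ^ j * z ^ (d - i - j)))"
      unfolding c P_def by (subst sum.Sigma) (auto simp: mult.assoc)
    also have "\<dots> = (\<Sum>(i, j)\<in>P. conic_K x y z * (c i j * T i j x y z)) +
        (\<Sum>(i, j)\<in>P. c i j * 4 ^ (j div 2) * M (2 * i + j) x y z)"
      unfolding sum.distrib[symmetric]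
    proof (intro sum.cong refl, clarify)
      fix i j assume "(i, j) \<in> P"
      then show "c i j * (x ^ i * y ^ j * z ^ (d - i - j)) =
          conic_K x y z * (c i j * T i j x y z) + c i j * 4 ^ (j div 2) * M (2 * i + j) x y z"
        unfolding T(3)[of x i y j z] mono[OF \<open>(i, j) \<in> P\<close>, symmetric]
        by (simp only: distrib_left mult_ac)
    qed
    also have "(\<Sum>(i, j)\<in>P. conic_K x y z * (c i j * T i j x y z)) = conic_K x y z * U x y z"
      unfolding U_def P_def sum_distrib_left by (subst sum.Sigma) auto
    also have "(\<Sum>(i, j)\<in>P. c i j * 4 ^ (j div 2) * M (2 * i + j) x y z) =
        (\<Sum>m\<le>2 * d. \<Sum>(i, j)\<in>{p \<in> P. 2 * fst p + snd p = m}. c i j * 4 ^ (j div 2) * M (2 * i + j) x y z)"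
      using finP by (intro sum.group[symmetric]) (auto simp: P_def)
    also have "\<dots> = (\<Sum>m\<le>2 * d. e m * M m x y z)"
      unfolding e_def sum_distrib_right by (intro sum.cong refl) auto
    finally show ?thesis .
  qed
  define r where "r = (\<Sum>m\<le>2 * d. monom (e m * (- 2) ^ (m mod 2)) m)"
  have "poly r s = F (s\<^sup>2) (- 2 * s) 1" for s
  proof -
    have "M m (s\<^sup>2) (- 2 * s) 1 = (- 2) ^ (m mod 2) * s ^ m" for m
    proof -
      have "M m (s\<^sup>2) (- 2 * s) 1 = (- 2) ^ (m mod 2) * (s ^ (2 * (m div 2) + m mod 2))"
        unfolding M_def power_mult_distrib power_add power_mult by simp
      then show ?thesis by simp
    qed
    then show ?thesis
      unfolding F_eq r_def poly_sum poly_monom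
      by (simp add: conic_K_def power_mult_distrib mult.assoc)
  qed
  then have "infinite {s. poly r s = 0}" using inf by simp
  then have "r = 0" using poly_roots_finite by blast
  have "e m = 0" if "m \<le> 2 * d" for m
  proof -
    have "coeff r m = (\<Sum>k\<le>2 * d. if k = m then e k * (- 2) ^ (k mod 2) else 0)"
      by (simp add: r_def coeff_sum)
    also have "\<dots> = e m * (- 2) ^ (m mod 2)"
      using that by (simp add: sum.delta)
    finally show ?thesis using \<open>r = 0\<close> by simp
  qed
  then have "F x y z = conic_K x y z * U x y z" for x y z
    unfolding F_eq by simp
  moreover have "is_form (d - 2) U"
    unfolding U_def
  proof (intro is_form_sum is_form_scale)
    fix i j assume "i \<in> {..d}" "j \<in> {..d - i}"
    then have "i + j + (d - i - j) - 2 = d - 2" by auto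
    then show "is_form (d - 2) (T i j)" using T(1)[of i j] by simp
  qed
  moreover have "U = (\<lambda>_ _ _. 0)" if "d < 2"
    unfolding U_def using that by (intro ext sum.neutral ballI) (auto simp: T(2))
  ultimately show ?thesis by blast
qed

text \<open>A \<open>curve\<close> contains all multiples of its triples and is infinite once
  nonempty; in the chart \<open>z2 = 1\<close> infinite means infinitely many points.\<close>

definition affine_zeros :: "ternary \<Rightarrow> (complex \<times> complex) set" where
  "affine_zeros F = {(x, y). F x y 1 = 0}"

text \<open>The linear change \<open>p\<close> with inverse \<open>q\<close> transports divisibility
  by \<open>conic_K\<close> to its pullback: infinitely many points of the chart have infinitely
  many parameters on \<open>conic_K\<close>.\<close>

lemma conic_chart_dvd:
  assumes p: "is_form 1 p0" "is_form 1 p1" "is_form 1 p2"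
    and q: "is_form 1 q0" "is_form 1 q1" "is_form 1 q2"
    and inv: "\<And>x y z. q0 (p0 x y z) (p1 x y z) (p2 x y z) = x"
      "\<And>x y z. q1 (p0 x y z) (p1 x y z) (p2 x y z) = y"
      "\<And>x y z. q2 (p0 x y z) (p1 x y z) (p2 x y z) = z"
    and F: "is_form d F"
    and inf: "infinite (affine_zeros F \<inter>
      affine_zeros (\<lambda>x y z. conic_K (p0 x y z) (p1 x y z) (p2 x y z)))" (is "infinite ?Z")
  shows "\<exists>T. is_form (d - 2) T \<and> (d < 2 \<longrightarrow> T = (\<lambda>_ _ _. 0)) \<and>
     (\<forall>x y z. F x y z = conic_K (p0 x y z) (p1 x y z) (p2 x y z) * T x y z)"
proof -
  define F' where "F' = (\<lambda>x y z. F (q0 x y z) (q1 x y z) (q2 x y z))"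
  have F': "is_form d F'" unfolding F'_def by (rule is_form_compose[OF F q])
  have FF': "F x y z = F' (p0 x y z) (p1 x y z) (p2 x y z)" for x y z
    by (simp add: F'_def inv)
  \<comment> \<open>The parameter of the image point; \<open>None\<close> stands for
    \<open>(1, 0, 0)\<close>, the only point of the conic missed by
    \<open>(s\<^sup>2, - 2 * s, 1)\<close>.\<close>
  define \<sigma> where "\<sigma> = (\<lambda>(x, y). if p2 x y 1 = 0 then None else Some (- p1 x y 1 / (2 * p2 x y 1)))"
  define r0 :: "complex option \<Rightarrow> complex" where "r0 = (\<lambda>a. case a of None \<Rightarrow> 1 | Some s \<Rightarrow> s\<^sup>2)"
  define r1 :: "complex option \<Rightarrow> complex" where "r1 = (\<lambda>a. case a of None \<Rightarrow> 0 | Some s \<Rightarrow> - 2 * s)"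
  define r2 :: "complex option \<Rightarrow> complex" where "r2 = (\<lambda>a. case a of None \<Rightarrow> 0 | Some s \<Rightarrow> 1)"
  have scale: "\<exists>l. p0 x y 1 = l * r0 (\<sigma> (x, y)) \<and> p1 x y 1 = l * r1 (\<sigma> (x, y)) \<and> p2 x y 1 = l * r2 (\<sigma> (x, y))"
    if "(x, y) \<in> ?Z" for x y
  proof -
    have K: "(p1 x y 1)\<^sup>2 = 4 * p0 x y 1 * p2 x y 1"
      using that by (simp add: affine_zeros_def conic_K_def)
    show ?thesis
    proof (cases "p2 x y 1 = 0")
      case True
      then show ?thesis using K by (simp add: \<sigma>_def r0_def r1_def r2_def)
    next
      case False
      then have "p0 x y 1 = p2 x y 1 * (- p1 x y 1 / (2 * p2 x y 1))\<^sup>2"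
        using K by (simp add: field_simps power2_eq_square)
      then show ?thesis using False
        by (intro exI[of _ "p2 x y 1"]) (simp add: \<sigma>_def r0_def r1_def r2_def)
    qed
  qed
  have "inj_on \<sigma> ?Z"
  proof (rule inj_onI)
    fix u u' assume u: "u \<in> ?Z" "u' \<in> ?Z" "\<sigma> u = \<sigma> u'"
    obtain x y x' y' where xy: "u = (x, y)" "u' = (x', y')" by (cases u, cases u') auto
    note * = u[unfolded xy]
    obtain l where l: "p0 x y 1 = l * r0 (\<sigma> (x, y))" "p1 x y 1 = l * r1 (\<sigma> (x, y))"
      "p2 x y 1 = l * r2 (\<sigma> (x, y))" using scale[OF *(1)] by blast
    obtain l' where l': "p0 x' y' 1 = l' * r0 (\<sigma> (x, y))" "p1 x' y' 1 = l' * r1 (\<sigma> (x, y))"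
      "p2 x' y' 1 = l' * r2 (\<sigma> (x, y))" using scale[OF *(2)] *(3) by auto
    have hom: "f (m * a) (m * b) (m * c) = m * f a b c" if "is_form 1 f" for f m a b c
      using is_form_homogeneous[OF that] by simp
    note e = inv[of x y 1, unfolded l hom[OF q(1)] hom[OF q(2)] hom[OF q(3)]]
    note e' = inv[of x' y' 1, unfolded l' hom[OF q(1)] hom[OF q(2)] hom[OF q(3)]]
    \<comment> \<open>Points with equal parameters are proportional, and their common third
      coordinate 1 fixes the factor.\<close>
    have "l = l'" using e(3) e'(3) by (metis mult_cancel_right mult_zero_right zero_neq_one)
    then show "u = u'" using e(1,2) e'(1,2) by (simp add: xy)
  qed
  then have "infinite (\<sigma> ` ?Z)" using inf finite_image_iff by blast
  moreover have "\<sigma> ` ?Z \<subseteq> insert None (Some ` {s. F' (s\<^sup>2) (- 2 * s) 1 = 0})"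
  proof
    fix a assume "a \<in> \<sigma> ` ?Z"
    then obtain u where u: "a = \<sigma> u" "u \<in> ?Z" by (rule imageE)
    obtain x y where "u = (x, y)" by (cases u) auto
    with u have *: "(x, y) \<in> ?Z" "a = \<sigma> (x, y)" by simp_all
    show "a \<in> insert None (Some ` {s. F' (s\<^sup>2) (- 2 * s) 1 = 0})"
    proof (cases a)
      case (Some s)
      then have s: "\<sigma> (x, y) = Some s" using *(2) by simp
      then have "p2 x y 1 \<noteq> 0" by (auto simp: \<sigma>_def split: if_splits)
      obtain l where l: "p0 x y 1 = l * s\<^sup>2" "p1 x y 1 = l * (- 2 * s)" "p2 x y 1 = l * 1"
        using scale[OF *(1)] s by (auto simp: r0_def r1_def r2_def)
      have "0 = F' (p0 x y 1) (p1 x y 1) (p2 x y 1)"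
        using *(1) FF' by (simp add: affine_zeros_def)
      also have "\<dots> = l ^ d * F' (s\<^sup>2) (- 2 * s) 1"
        unfolding l by (rule is_form_homogeneous[OF F'])
      finally have "F' (s\<^sup>2) (- 2 * s) 1 = 0" using \<open>p2 x y 1 \<noteq> 0\<close> l(3) by auto
      then show ?thesis using Some by blast
    qed simp
  qed
  ultimately have "infinite (insert None (Some ` {s. F' (s\<^sup>2) (- 2 * s) 1 = 0}))"
    by (rule infinite_super[rotated])
  then have "infinite {s. F' (s\<^sup>2) (- 2 * s) 1 = 0}" by auto
  from conic_K_dvd_form[OF F' this] obtain T where T: "is_form (d - 2) T"
    "d < 2 \<Longrightarrow> T = (\<lambda>_ _ _. 0)" "\<And>x y z. F' x y z = conic_K x y z * T x y z"
    by blast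
  have "is_form (d - 2) (\<lambda>x y z. T (p0 x y z) (p1 x y z) (p2 x y z))"
    by (rule is_form_compose[OF T(1) p])
  moreover have "(\<lambda>x y z. T (p0 x y z) (p1 x y z) (p2 x y z)) = (\<lambda>_ _ _. 0)" if "d < 2"
    using T(2)[OF that] by simp
  moreover have "F x y z = conic_K (p0 x y z) (p1 x y z) (p2 x y z) *
      T (p0 x y z) (p1 x y z) (p2 x y z)" for x y z
    unfolding FF' by (rule T(3))
  ultimately show ?thesis by blast
qed

text \<open>The Bezout property of an irreducible conic, in the form that lets several conics be
  divided out one after the other.\<close>

definition prime_conic :: "ternary \<Rightarrow> bool" where
  "prime_conic Q \<longleftrightarrow> is_form 2 Q \<and> Q \<noteq> (\<lambda>_ _ _. 0) \<and> infinite (affine_zeros Q) \<and>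
     (\<forall>d F. is_form d F \<longrightarrow> infinite (affine_zeros F \<inter> affine_zeros Q) \<longrightarrow>
        (\<exists>T. is_form (d - 2) T \<and> (d < 2 \<longrightarrow> T = (\<lambda>_ _ _. 0)) \<and> (\<forall>x y z. F x y z = Q x y z * T x y z)))"

lemma prime_conic_dvd:
  assumes "prime_conic Q" "is_form d F" "infinite (affine_zeros F \<inter> affine_zeros Q)"
  obtains T where "is_form (d - 2) T" "d < 2 \<Longrightarrow> T = (\<lambda>_ _ _. 0)" "\<And>x y z. F x y z = Q x y z * T x y z"
  using assms unfolding prime_conic_def by blast

lemma affine_zeros_mult:
  "affine_zeros (\<lambda>x y z. A x y z * B x y z) = affine_zeros A \<union> affine_zeros B"
  by (auto simp: affine_zeros_def)

text \<open>One of two linear factors would vanish at infinitely many points of \<open>Q\<close>,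
  and the clause for \<open>d < 2\<close> makes it zero.\<close>

lemma prime_conic_irreducible:
  assumes Q: "prime_conic Q"
  shows "irreducible_conic Q"
proof -
  have zero: "A = (\<lambda>_ _ _. 0)" if "is_form 1 A" "infinite (affine_zeros A \<inter> affine_zeros Q)" for A
    using prime_conic_dvd[OF Q that] by (metis mult_zero_right one_less_numeral_iff semiring_norm(76) ext)
  have "\<not> (\<forall>x y z. Q x y z = A x y z * B x y z)" if AB: "is_form 1 A" "is_form 1 B" for A B
  proof
    assume eq: "\<forall>x y z. Q x y z = A x y z * B x y z"
    then have "affine_zeros Q = (affine_zeros A \<inter> affine_zeros Q) \<union> (affine_zeros B \<inter> affine_zeros Q)"
      by (auto simp: affine_zeros_def)
    then have "infinite (affine_zeros A \<inter> affine_zeros Q) \<or> infinite (affine_zeros B \<inter> affine_zeros Q)"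
      using Q by (metis finite_UnI prime_conic_def)
    then have "A = (\<lambda>_ _ _. 0) \<or> B = (\<lambda>_ _ _. 0)" using zero AB by blast
    then have "Q = (\<lambda>_ _ _. 0)" using eq by (intro ext) auto
    then show False using Q by (simp add: prime_conic_def)
  qed
  moreover have "a = 1 \<and> b = 1" if "0 < a" "0 < b" "a + b = (2::nat)" for a b
    using that by auto
  moreover have "\<exists>x y z. Q x y z \<noteq> 0"
    using Q by (auto simp: prime_conic_def fun_eq_iff)
  ultimately show ?thesis
    using Q unfolding irreducible_form_def prime_conic_def by (metis zero_less_numeral)
qed

text \<open>The conics already divided out meet the next one in finitely many points, so the
  quotient keeps infinitely many of its zeros there.\<close>

lemma prime_conics_prod_dvd:
  assumes "distinct bs" and "\<And>b. b \<in> set bs \<Longrightarrow> prime_conic (Q b)"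
    and "\<And>b b'. b \<in> set bs \<Longrightarrow> b' \<in> set bs \<Longrightarrow> b \<noteq> b' \<Longrightarrow> finite (affine_zeros (Q b') \<inter> affine_zeros (Q b))"
    and F: "is_form d F" and "\<And>b. b \<in> set bs \<Longrightarrow> infinite (affine_zeros F \<inter> affine_zeros (Q b))"
  shows "\<exists>T. is_form (d - 2 * length bs) T \<and> (\<forall>x y z. F x y z = T x y z * (\<Prod>C\<leftarrow>map Q bs. C x y z))"
  using assms(1,2,3,5)
proof (induction bs)
  case Nil
  then show ?case using F by auto
next
  case (Cons b bs)
  have "\<exists>T. is_form (d - 2 * length bs) T \<and> (\<forall>x y z. F x y z = T x y z * (\<Prod>C\<leftarrow>map Q bs. C x y z))"
    using Cons.prems by (intro Cons.IH) auto
  then obtain T where T: "is_form (d - 2 * length bs) T"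
    "\<And>x y z. F x y z = T x y z * (\<Prod>C\<leftarrow>map Q bs. C x y z)" by blast
  have "affine_zeros (\<lambda>x y z. \<Prod>C\<leftarrow>map Q cs. C x y z) = (\<Union>c\<in>set cs. affine_zeros (Q c))" for cs
    by (induction cs) (auto simp: affine_zeros_def)
  moreover have "F = (\<lambda>x y z. T x y z * (\<Prod>C\<leftarrow>map Q bs. C x y z))" using T(2) by (intro ext)
  ultimately have "affine_zeros F \<inter> affine_zeros (Q b) = (affine_zeros T \<inter> affine_zeros (Q b)) \<union>
      (\<Union>c\<in>set bs. affine_zeros (Q c) \<inter> affine_zeros (Q b))"
    using affine_zeros_mult[of T] by auto
  moreover have "finite (\<Union>c\<in>set bs. affine_zeros (Q c) \<inter> affine_zeros (Q b))"
    using Cons.prems by (intro finite_UN_I) auto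
  ultimately have "infinite (affine_zeros T \<inter> affine_zeros (Q b))"
    using Cons.prems(4)[of b] by auto
  then obtain U where U: "is_form (d - 2 * length bs - 2) U" "\<And>x y z. T x y z = Q b x y z * U x y z"
    using prime_conic_dvd[OF Cons.prems(2)[of b] T(1)] by (metis list.set_intros(1))
  then show ?case
    by (intro exI[of _ U]) (auto simp: T(2) mult_ac diff_diff_left add_ac)
qed

text \<open>With infinitely many common points the two would be proportional, which a point on only
  one of them excludes.\<close>

lemma prime_conics_finite_inter:
  assumes "prime_conic Q" "prime_conic Q'" "Q' x y z = 0" "Q x y z \<noteq> 0"
  shows "finite (affine_zeros Q' \<inter> affine_zeros Q)"
proof (rule ccontr)
  assume "infinite (affine_zeros Q' \<inter> affine_zeros Q)"
  moreover have "is_form 2 Q'" using assms(2) by (simp add: prime_conic_def)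
  ultimately obtain T where T: "is_form (2 - 2) T" "\<And>x y z. Q' x y z = Q x y z * T x y z"
    using prime_conic_dvd[OF assms(1)] by metis
  have "T x y z = 0" using assms(3,4) T(2)[of x y z] by simp
  then have "T = (\<lambda>_ _ _. 0)" using is_form_0_const[of T] T(1) by (intro ext) (metis diff_self_eq_0)
  then have "Q' = (\<lambda>_ _ _. 0)" using T(2) by (intro ext) simp
  then show False using assms(2) by (simp add: prime_conic_def)
qed

section \<open>Conics through the integral curves\<close>

text \<open>The biquadratic curve, with both Darboux coordinates translated by \<open>e\<close>.\<close>

definition euler_conic :: "complex \<Rightarrow> complex \<Rightarrow> complex \<Rightarrow> complex \<Rightarrow> complex \<Rightarrow> complex \<Rightarrow> ternary" where
  "euler_conic A B C D e b x y z = conic_K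
     ((A + B * b) * x + ((A + B * b) * e - A * b) * y + ((A + B * b) * e\<^sup>2 - 2 * A * b * e) * z)
     (C * b * x + (C * b * e + A) * y + (C * b * e\<^sup>2 + 2 * A * e - A * b) * z)
     (D * b * x + D * b * e * y + (A + D * b * e\<^sup>2) * z)"

lemma euler_conic_Darboux:
  "euler_conic A B C D e b (x * y) (- (x + y)) 1 = euler_biquadratic A B C D b (x - e) (y - e)"
  unfolding euler_conic_def conic_K_def euler_biquadratic_def power2_eq_square by algebra

text \<open>The points with one Darboux coordinate \<open>e\<close> form a tangent line of
  \<open>conic_K\<close>. For \<open>A \<noteq> 0\<close> the conic touches it where the other
  coordinate is \<open>e + b\<close>, and this contact point tells the conics apart.\<close>

lemma euler_conic_at_base:
  "euler_conic A B C D e b (e * y) (- (e + y)) 1 = A\<^sup>2 * (y - e - b)\<^sup>2"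
  unfolding euler_conic_Darboux euler_biquadratic_def power2_eq_square by algebra

text \<open>The three linear forms inside \<open>euler_conic\<close> have determinant
  \<open>A\<^sup>2 * \<delta>\<close>, where \<open>b * \<delta>\<close> is the value of the quartic
  at \<open>b\<close>; so they are a change of coordinates.\<close>

lemma prime_conic_euler_conic:
  assumes A: "A \<noteq> 0" and b: "b \<noteq> 0" and \<Delta>: "poly [:0, A, B, C, D:] b \<noteq> 0"
    and inf: "infinite (affine_zeros (euler_conic A B C D e b))"
  shows "prime_conic (euler_conic A B C D e b)"
proof -
  define p0 where "p0 = (\<lambda>x y z. (A + B * b) * x + ((A + B * b) * e - A * b) * y +
    ((A + B * b) * e\<^sup>2 - 2 * A * b * e) * z)"
  define p1 where "p1 = (\<lambda>x y z. C * b * x + (C * b * e + A) * y + (C * b * e\<^sup>2 + 2 * A * e - A * b) * z)"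
  define p2 where "p2 = (\<lambda>x y z. D * b * x + D * b * e * y + (A + D * b * e\<^sup>2) * z)"
  have p: "is_form 1 p0" "is_form 1 p1" "is_form 1 p2"
    unfolding p0_def p1_def p2_def by (rule is_form_linear)+
  have eq: "euler_conic A B C D e b = (\<lambda>x y z. conic_K (p0 x y z) (p1 x y z) (p2 x y z))"
    by (intro ext) (simp add: euler_conic_def p0_def p1_def p2_def)
  define \<delta> where "\<delta> = A + B * b + C * b\<^sup>2 + D * b ^ 3"
  have "poly [:0, A, B, C, D:] b = b * \<delta>"
    by (simp add: \<delta>_def power2_eq_square power3_eq_cube algebra_simps)
  then have \<delta>: "\<delta> \<noteq> 0" using \<Delta> by auto
  \<comment> \<open>The combination \<open>p0 + b * p1 + b\<^sup>2 * p2\<close> isolates the first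
    translated coordinate; \<open>p0\<close> and \<open>p2\<close> then give the other two.\<close>
  define r0 where "r0 = (\<lambda>x y z. 1 / \<delta> * x + b / \<delta> * y + b\<^sup>2 / \<delta> * z)"
  define r2 where "r2 = (\<lambda>x y z. - (D * b / A) * r0 x y z + (0 * x + 0 * y + 1 / A * z))"
  define r1 where "r1 = (\<lambda>x y z. (A + B * b) / (A * b) * r0 x y z + (- 1 / (A * b) * x + 0 * y + 0 * z))"
  have r0: "is_form 1 r0" unfolding r0_def by (rule is_form_linear)
  have r1: "is_form 1 r1" unfolding r1_def by (rule is_form_add[OF is_form_scale[OF r0] is_form_linear])
  have r2: "is_form 1 r2" unfolding r2_def by (rule is_form_add[OF is_form_scale[OF r0] is_form_linear])
  \<comment> \<open>\<open>q0\<close> and \<open>q1\<close> undo the translation of the Darboux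
    coordinates by \<open>e\<close>.\<close>
  define q0 where "q0 = (\<lambda>x y z. r0 x y z + (- e * r1 x y z + e\<^sup>2 * r2 x y z))"
  define q1 where "q1 = (\<lambda>x y z. r1 x y z + - 2 * e * r2 x y z)"
  have q0: "is_form 1 q0"
    unfolding q0_def by (rule is_form_add[OF r0 is_form_add[OF is_form_scale[OF r1] is_form_scale[OF r2]]])
  have q1: "is_form 1 q1"
    unfolding q1_def by (rule is_form_add[OF r1 is_form_scale[OF r2]])
  have R0: "r0 (p0 x y z) (p1 x y z) (p2 x y z) = x + e * y + e\<^sup>2 * z" for x y z
  proof -
    have "p0 x y z + b * p1 x y z + b\<^sup>2 * p2 x y z = \<delta> * (x + e * y + e\<^sup>2 * z)"
      unfolding p0_def p1_def p2_def \<delta>_def power2_eq_square power3_eq_cube by algebra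
    then show ?thesis using \<delta> by (simp add: r0_def field_simps)
  qed
  have R1: "r1 (p0 x y z) (p1 x y z) (p2 x y z) = y + 2 * e * z" for x y z
  proof -
    have "(A + B * b) * (x + e * y + e\<^sup>2 * z) - p0 x y z = A * b * (y + 2 * e * z)"
      unfolding p0_def by algebra
    then show ?thesis unfolding r1_def R0 using A b by (simp add: field_simps)
  qed
  have R2: "r2 (p0 x y z) (p1 x y z) (p2 x y z) = z" for x y z
  proof -
    have "p2 x y z = D * b * (x + e * y + e\<^sup>2 * z) + A * z"
      unfolding p2_def by algebra
    moreover have "- (D * b / A) * w + (0 * u + 0 * v + 1 / A * (D * b * w + A * z)) = z" for u v w
      using A by (simp add: add_divide_distrib distrib_left)
    ultimately show ?thesis unfolding r2_def R0 by presburger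
  qed
  have inv: "q0 (p0 x y z) (p1 x y z) (p2 x y z) = x" "q1 (p0 x y z) (p1 x y z) (p2 x y z) = y" for x y z
    unfolding q0_def q1_def R0 R1 R2 by (simp_all add: power2_eq_square algebra_simps)
  have "is_form 2 (euler_conic A B C D e b)"
    unfolding eq by (rule is_form_compose[OF is_form_conic_K p])
  moreover have "euler_conic A B C D e b \<noteq> (\<lambda>_ _ _. 0)"
  proof
    assume "euler_conic A B C D e b = (\<lambda>_ _ _. 0)"
    then have "A\<^sup>2 * (e + b + 1 - e - b)\<^sup>2 = 0"
      unfolding euler_conic_at_base[of A B C D e b "e + b + 1", symmetric] by simp
    then show False using A by simp
  qed
  ultimately show ?thesis
    using inf conic_chart_dvd[OF p q0 q1 r2 inv R2] unfolding prime_conic_def eq by blast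
qed

section \<open>Gradients of forms and transversality to \<open>conic_K\<close>\<close>

lemma form_chain_rule:
  assumes F: "is_form d F"
    and a: "(a has_field_derivative a') (at s)" and b: "(b has_field_derivative b') (at s)"
    and c: "(c has_field_derivative c') (at s)"
  shows "((\<lambda>s. F (a s) (b s) (c s)) has_field_derivative
     (d0 F (a s) (b s) (c s) * a' + d1 F (a s) (b s) (c s) * b' + d2 F (a s) (b s) (c s) * c')) (at s)"
proof -
  obtain k where k:
    "\<And>x y z. F x y z = (\<Sum>i\<le>d. \<Sum>j\<le>d - i. k i j * x ^ i * y ^ j * z ^ (d - i - j))"
    using F unfolding is_form_def by blast
  define F0 where "F0 = (\<lambda>x y z. \<Sum>i\<le>d. \<Sum>j\<le>d - i.
    k i j * (of_nat i * x ^ (i - 1)) * y ^ j * z ^ (d - i - j))"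
  define F1 where "F1 = (\<lambda>x y z. \<Sum>i\<le>d. \<Sum>j\<le>d - i.
    k i j * x ^ i * (of_nat j * y ^ (j - 1)) * z ^ (d - i - j))"
  define F2 where "F2 = (\<lambda>x y z. \<Sum>i\<le>d. \<Sum>j\<le>d - i.
    k i j * x ^ i * y ^ j * (of_nat (d - i - j) * z ^ (d - i - j - 1)))"
  have *: "((\<lambda>s. F (a s) (b s) (c s)) has_field_derivative
     (F0 (a s) (b s) (c s) * a' + F1 (a s) (b s) (c s) * b' + F2 (a s) (b s) (c s) * c')) (at s)"
    if a: "(a has_field_derivative a') (at s)" and b: "(b has_field_derivative b') (at s)"
    and c: "(c has_field_derivative c') (at s)" for a b c :: "complex \<Rightarrow> complex" and a' b' c' s
  proof -
    have m: "((\<lambda>s. k i j * a s ^ i * b s ^ j * c s ^ l) has_field_derivative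
       (k i j * (of_nat i * a s ^ (i - 1)) * b s ^ j * c s ^ l * a' +
        k i j * a s ^ i * (of_nat j * b s ^ (j - 1)) * c s ^ l * b' +
        k i j * a s ^ i * b s ^ j * (of_nat l * c s ^ (l - 1)) * c')) (at s)" for i j l
      by (rule derivative_eq_intros a b c refl)+ (simp add: algebra_simps)
    show ?thesis
      unfolding k F0_def F1_def F2_def sum_distrib_right sum.distrib[symmetric]
      by (intro DERIV_sum m)
  qed
  have "d0 F x y z = F0 x y z" for x y z
    unfolding d0_def by (rule DERIV_imp_deriv)
      (use *[OF DERIV_ident DERIV_const DERIV_const, of y z x] in simp)
  moreover have "d1 F x y z = F1 x y z" for x y z
    unfolding d1_def by (rule DERIV_imp_deriv)
      (use *[OF DERIV_const DERIV_ident DERIV_const, of x z y] in simp)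
  moreover have "d2 F x y z = F2 x y z" for x y z
    unfolding d2_def by (rule DERIV_imp_deriv)
      (use *[OF DERIV_const DERIV_const DERIV_ident, of x y z] in simp)
  ultimately show ?thesis using *[OF a b c] by simp
qed

lemma form_euler_identity:
  assumes "is_form d F"
  shows "d0 F x y z * x + d1 F x y z * y + d2 F x y z * z = of_nat d * F x y z"
proof -
  have "((\<lambda>s. F (s * x) (s * y) (s * z)) has_field_derivative
     (d0 F (1 * x) (1 * y) (1 * z) * x + d1 F (1 * x) (1 * y) (1 * z) * y + d2 F (1 * x) (1 * y) (1 * z) * z)) (at 1)"
    by (rule form_chain_rule[OF assms]) (auto intro!: derivative_eq_intros)
  moreover have "((\<lambda>s. F (s * x) (s * y) (s * z)) has_field_derivative of_nat d * F x y z) (at 1)"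
    unfolding is_form_homogeneous[OF assms] by (auto intro!: derivative_eq_intros)
  ultimately show ?thesis using DERIV_unique by fastforce
qed

lemma conic_K_gradient:
  "d0 conic_K x y z = - 4 * z" "d1 conic_K x y z = 2 * y" "d2 conic_K x y z = - 4 * x"
  unfolding d0_def d1_def d2_def conic_K_def
  by (rule DERIV_imp_deriv, auto intro!: derivative_eq_intros)+

text \<open>Points of \<open>conic_K\<close> have equal Darboux coordinates, where
  \<open>x - y\<close> vanishes; the value of \<open>S\<close> appears on differentiating the
  defining identity in \<open>y\<close> at \<open>y = x\<close>.\<close>

lemma poncelet_darboux_on_conic_K:
  assumes "poncelet_darboux n \<phi> f S"
  shows "S (x\<^sup>2) (- 2 * x) 1 = poly (wronskian \<phi> f) x"
proof -
  obtain p where p: "\<And>s. S (poly [:0, x:] s) (poly [:- x, - 1:] s) (poly [:1:] s) = poly p s"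
    using is_form_compose_poly[of "n - 1" S] assms unfolding poncelet_darboux_def by blast
  have "poly ([:x, - 1:] * p) y = poly (smult (poly \<phi> x) f - smult (poly f x) \<phi>) y" for y
  proof -
    have "(x - y) * S (x * y) (- (x + y)) 1 = poly \<phi> x * poly f y - poly \<phi> y * poly f x"
      using assms unfolding poncelet_darboux_def by blast
    moreover have "S (x * y) (- (x + y)) 1 = poly p y"
      using p[of y] by (simp add: mult.commute)
    ultimately show ?thesis by (simp add: algebra_simps)
  qed
  then have "[:x, - 1:] * p = smult (poly \<phi> x) f - smult (poly f x) \<phi>"
    by (simp add: poly_eq_poly_eq_iff[symmetric] fun_eq_iff)
  then have "poly (pderiv ([:x, - 1:] * p)) x = poly (pderiv (smult (poly \<phi> x) f - smult (poly f x) \<phi>)) x"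
    by simp
  moreover have "poly (pderiv ([:x, - 1:] * p)) x = - poly p x"
    by (subst pderiv_mult) (simp add: pderiv_pCons)
  moreover have "S (x\<^sup>2) (- 2 * x) 1 = poly p x"
    using p[of x] by (simp add: power2_eq_square)
  ultimately show ?thesis
    by (simp add: pderiv_diff pderiv_smult algebra_simps)
qed

text \<open>At a double root the gradient of \<open>S\<close> annihilates the tangent vector of the
  parametrized conic and, by Euler's identity, the position vector. This makes it a multiple of the
  gradient of \<open>conic_K\<close>.\<close>

lemma transversal_simple_roots:
  assumes S: "poncelet_darboux n \<phi> f S" and tr: "transversal S conic_K"
    and W: "poly (wronskian \<phi> f) x = 0" (is "poly ?W x = 0")
  shows "poly (pderiv ?W) x \<noteq> 0"
proof
  assume W': "poly (pderiv ?W) x = 0"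
  have form: "is_form (n - 1) S" using S by (simp add: poncelet_darboux_def)
  define D0 D1 D2 where "D0 = d0 S (x\<^sup>2) (- 2 * x) 1" and "D1 = d1 S (x\<^sup>2) (- 2 * x) 1"
    and "D2 = d2 S (x\<^sup>2) (- 2 * x) 1"
  have S0: "S (x\<^sup>2) (- 2 * x) 1 = 0"
    using poncelet_darboux_on_conic_K[OF S] W by simp
  have "((\<lambda>s. S (s\<^sup>2) (- 2 * s) 1) has_field_derivative (D0 * (2 * x) + D1 * (- 2) + D2 * 0)) (at x)"
    unfolding D0_def D1_def D2_def
    by (rule form_chain_rule[OF form]) (auto intro!: derivative_eq_intros)
  moreover have "((\<lambda>s. S (s\<^sup>2) (- 2 * s) 1) has_field_derivative poly (pderiv ?W) x) (at x)"
    unfolding poncelet_darboux_on_conic_K[OF S] by (rule poly_DERIV)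
  ultimately have "D0 * (2 * x) + D1 * (- 2) + D2 * 0 = 0"
    using DERIV_unique W' by metis
  then have D1: "D1 = x * D0" by (simp add: mult.commute)
  have "D0 * x\<^sup>2 + D1 * (- 2 * x) + D2 * 1 = 0"
    using form_euler_identity[OF form, of "x\<^sup>2" "- 2 * x" 1] S0 by (simp add: D0_def D1_def D2_def)
  then have D2: "D2 = x\<^sup>2 * D0" unfolding D1 by (simp add: power2_eq_square algebra_simps)
  have "(x\<^sup>2, - 2 * x, 1) \<in> curve S \<inter> curve conic_K"
    using S0 by (simp add: curve_def conic_K_def power2_eq_square)
  \<comment> \<open>The two gradients are \<open>D0\<close> and \<open>- 4\<close> times
    \<open>(1, x, x\<^sup>2)\<close>, whence the coefficients \<open>1\<close> and
    \<open>D0 / 4\<close>.\<close>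
  then have "1 * D0 + D0 / 4 * d0 conic_K (x\<^sup>2) (- 2 * x) 1 = 0 \<and>
      1 * D1 + D0 / 4 * d1 conic_K (x\<^sup>2) (- 2 * x) 1 = 0 \<and>
      1 * D2 + D0 / 4 * d2 conic_K (x\<^sup>2) (- 2 * x) 1 = 0 \<longrightarrow> (1::complex) = 0 \<and> D0 / 4 = 0"
    using tr unfolding transversal_def D0_def D1_def D2_def by fast
  then show False by (simp add: conic_K_gradient D1 D2)
qed

section \<open>Ramification of the pencil\<close>

lemma coprime_complex_polyI:
  fixes p q :: "complex poly"
  assumes "p \<noteq> 0" and "\<And>x. poly p x = 0 \<Longrightarrow> poly q x \<noteq> 0"
  shows "coprime p q"
proof -
  have "degree (gcd p q) = 0"
  proof (rule ccontr)
    assume "degree (gcd p q) \<noteq> 0"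
    then obtain x where x: "poly (gcd p q) x = 0"
      using alg_closed_imp_poly_has_root[of "gcd p q"] by auto
    have "poly p x = 0" "poly q x = 0"
      using x by (meson gcd_dvd1 gcd_dvd2 poly_eq_0_iff_dvd dvd_trans)+
    then show False using assms(2) by blast
  qed
  then have "is_unit (gcd p q)" using assms(1) by (metis gcd_eq_0_iff is_unit_iff_degree)
  then show ?thesis by (simp only: is_unit_gcd)
qed

text \<open>The terms of degree \<open>2 * n - 1\<close> cancel; without this gain the four gcds
  would not exhaust the Wronskian.\<close>

lemma degree_wronskian_le:
  assumes "degree \<phi> = n" "degree f = n" "n \<ge> 1"
  shows "degree (wronskian \<phi> f) \<le> 2 * n - 2"
proof (rule degree_le, intro allI impI)
  fix i assume i: "2 * n - 2 < i"
  have le: "degree (pderiv \<phi> * f) \<le> 2 * n - 1" "degree (\<phi> * pderiv f) \<le> 2 * n - 1"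
    using degree_mult_le[of "pderiv \<phi>" f] degree_mult_le[of \<phi> "pderiv f"] assms
    by (simp_all add: degree_pderiv)
  show "coeff (wronskian \<phi> f) i = 0"
  proof (cases "i = 2 * n - 1")
    case True
    have "coeff (pderiv \<phi> * f) (n - 1 + n) = coeff (pderiv \<phi>) (n - 1) * coeff f n"
      using coeff_mult_degree_sum[of "pderiv \<phi>" f] assms by (simp add: degree_pderiv)
    moreover have "coeff (\<phi> * pderiv f) (n + (n - 1)) = coeff \<phi> n * coeff (pderiv f) (n - 1)"
      using coeff_mult_degree_sum[of \<phi> "pderiv f"] assms by (simp add: degree_pderiv)
    moreover have "n - 1 + n = i" "n + (n - 1) = i" "Suc (n - 1) = n" using True assms(3) by auto
    ultimately show ?thesis by (simp add: coeff_pderiv)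
  next
    case False
    then have "i > 2 * n - 1" using i by linarith
    then show ?thesis using le by (simp add: coeff_eq_0)
  qed
qed

text \<open>This invariance puts the multiple roots of all pencil members among the roots of a
  single polynomial.\<close>

lemma wronskian_pencil: "wronskian (pencil \<phi> f t) f = wronskian \<phi> f"
  by (simp add: pencil_def pderiv_add pderiv_smult algebra_simps)

text \<open>A root of multiplicity \<open>m\<close> of \<open>\<Phi>\<close> is a root of the
  Wronskian of multiplicity at least \<open>m - 1\<close>, so \<open>m\<close> is at most 2:
  \<open>g\<close> collects the double roots and \<open>q\<close> the simple ones.\<close>

lemma gcd_pderiv_square_factor:
  assumes W: "\<And>x. poly (wronskian \<Phi> f) x = 0 \<Longrightarrow> poly (pderiv (wronskian \<Phi> f)) x \<noteq> 0"
  defines "g \<equiv> gcd \<Phi> (pderiv \<Phi>)"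
  obtains q where "\<Phi> = q * g\<^sup>2" "g dvd wronskian \<Phi> f"
    "\<And>x. poly g x = 0 \<Longrightarrow> poly (pderiv g) x \<noteq> 0" "\<And>x. poly g x = 0 \<Longrightarrow> poly q x \<noteq> 0"
    "\<And>x. poly q x = 0 \<Longrightarrow> poly (pderiv q) x \<noteq> 0"
proof -
  have W_factor: "poly k x \<noteq> 0" if "wronskian \<Phi> f = g * k" "poly g x = 0" for k x
    using W[of x] that by (auto simp: pderiv_mult)
  have "wronskian \<Phi> f \<noteq> 0" using W by force
  then have "\<Phi> \<noteq> 0" by auto
  then have "g \<noteq> 0" by (simp add: g_def)
  obtain h k where h: "\<Phi> = g * h" and k: "pderiv \<Phi> = g * k"
    unfolding g_def by (meson dvdE gcd_dvd1 gcd_dvd2)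
  have Wg: "wronskian \<Phi> f = g * (k * f - h * pderiv f)"
    unfolding k by (subst h) (simp add: algebra_simps)
  have simple: "poly (pderiv g) x \<noteq> 0" if "poly g x = 0" for x
    using W[of x] that unfolding Wg pderiv_mult by auto
  have "coprime g (pderiv g)" by (rule coprime_complex_polyI) (use simple \<open>g \<noteq> 0\<close> in auto)
  moreover have "g * k = g * pderiv h + h * pderiv g"
    unfolding k[symmetric] by (subst h) (simp add: pderiv_mult)
  then have "g * (k - pderiv h) = h * pderiv g" by (simp add: algebra_simps)
  then have "g dvd h * pderiv g" by (metis dvd_triv_left)
  ultimately have "g dvd h" by (simp add: coprime_dvd_mult_left_iff)
  then obtain q where q: "h = g * q" by blast
  have \<Phi>: "\<Phi> = q * g\<^sup>2" by (simp add: h q power2_eq_square)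
  have \<Phi>': "pderiv \<Phi> = g * (pderiv q * g + 2 * q * pderiv g)"
    unfolding \<Phi> power2_eq_square by (simp add: pderiv_mult algebra_simps)
  have qg: "poly q x \<noteq> 0" if "poly g x = 0" for x
  proof
    assume "poly q x = 0"
    have "wronskian \<Phi> f = g * ((pderiv q * g + 2 * q * pderiv g) * f - q * g * pderiv f)"
      unfolding \<Phi>' by (subst \<Phi>) (simp add: power2_eq_square algebra_simps)
    from W_factor[OF this that] show False using \<open>poly q x = 0\<close> that by simp
  qed
  have "poly (pderiv q) x \<noteq> 0" if "poly q x = 0" for x
  proof
    assume "poly (pderiv q) x = 0"
    then have "poly \<Phi> x = 0" "poly (pderiv \<Phi>) x = 0"
      unfolding \<Phi>' using that by (simp_all add: \<Phi>)
    then have "poly g x = 0" by (simp add: g_def poly_eq_0_iff_dvd)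
    then show False using qg that by blast
  qed
  then show ?thesis using that[OF \<Phi> _ simple qg] Wg by (metis dvd_triv_left)
qed

lemma card_simple_roots:
  fixes p :: "complex poly"
  assumes "\<And>x. poly p x = 0 \<Longrightarrow> poly (pderiv p) x \<noteq> 0"
  shows "card {x. poly p x = 0} = degree p"
proof -
  have "p \<noteq> 0" using assms by force
  have "rsquarefree p" using assms by (auto simp: rsquarefree_roots)
  then have "degree p = degree (smult (lead_coeff p) (\<Prod>z|poly p z = 0. [:- z, 1:]))"
    by (simp only: complex_poly_decompose_rsquarefree)
  also have "\<dots> = card {x. poly p x = 0}"
    using \<open>p \<noteq> 0\<close> by (simp add: degree_prod_sum_eq)
  finally show ?thesis by simp
qed

lemma prod_dvd_of_pairwise_coprime:
  fixes g :: "'a \<Rightarrow> complex poly"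
  assumes "finite T" "\<And>t. t \<in> T \<Longrightarrow> g t dvd w"
    and "\<And>t t'. t \<in> T \<Longrightarrow> t' \<in> T \<Longrightarrow> t \<noteq> t' \<Longrightarrow> coprime (g t) (g t')"
  shows "(\<Prod>t\<in>T. g t) dvd w"
  using assms
proof (induction T)
  case (insert t T)
  have "coprime (g t) (\<Prod>t\<in>T. g t)"
    using insert by (intro prod_coprime_right) auto
  then show ?case using insert by (simp add: divides_mult)
qed simp

text \<open>This is the case of equality in the Riemann-Hurwitz formula: \<open>\<phi> / f\<close> is ramified only over the
  four given values, so its Wronskian is the product of the four gcds.\<close>

lemma wronskian_square_factor:
  fixes \<phi> f :: "complex poly" and T :: "complex set"
  assumes deg: "degree \<phi> = n" "degree f = n" "n \<ge> 1"
    and common: "\<not> (\<exists>z. poly \<phi> z = 0 \<and> poly f z = 0)"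
    and W: "\<And>x. poly (wronskian \<phi> f) x = 0 \<Longrightarrow> poly (pderiv (wronskian \<phi> f)) x \<noteq> 0"
    and T: "card T = 4"
  defines "g \<equiv> \<lambda>t. gcd (pencil \<phi> f t) (pderiv (pencil \<phi> f t))"
  assumes total: "(\<Sum>t\<in>T. degree (g t)) = 2 * n - 2"
  obtains q \<kappa> where "\<And>t. pencil \<phi> f t = q t * (g t)\<^sup>2"
    "\<And>t x. poly (g t) x = 0 \<Longrightarrow> poly (pderiv (g t)) x \<noteq> 0"
    "\<And>t t' x. poly (g t) x = 0 \<Longrightarrow> poly (q t') x \<noteq> 0"
    "\<And>t x. poly (q t) x = 0 \<Longrightarrow> poly (pderiv (q t)) x \<noteq> 0"
    "(wronskian \<phi> f)\<^sup>2 * (\<Prod>t\<in>T. q t) = smult \<kappa> (\<Prod>t\<in>T. pencil \<phi> f t)"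
    "degree (\<Prod>t\<in>T. q t) \<le> 4"
proof -
  have finT: "finite T" using T card_ge_0_finite[of T] by simp
  have W0: "wronskian \<phi> f \<noteq> 0" using W by force
  have disjoint: "t = t'" if "poly (pencil \<phi> f t) x = 0" "poly (pencil \<phi> f t') x = 0" for t t' x
  proof (rule ccontr)
    assume "t \<noteq> t'"
    have "poly \<phi> x + t * poly f x = 0" "poly \<phi> x + t' * poly f x = 0"
      using that by (simp_all add: pencil_def)
    then have "(t - t') * poly f x = 0" by algebra
    then have "poly f x = 0" using \<open>t \<noteq> t'\<close> by simp
    then show False using that(1) common by (auto simp: pencil_def)
  qed
  have "\<exists>q. pencil \<phi> f t = q * (g t)\<^sup>2 \<and> g t dvd wronskian \<phi> f \<and>
      (\<forall>x. poly (g t) x = 0 \<longrightarrow> poly (pderiv (g t)) x \<noteq> 0) \<and>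
      (\<forall>x. poly (g t) x = 0 \<longrightarrow> poly q x \<noteq> 0) \<and> (\<forall>x. poly q x = 0 \<longrightarrow> poly (pderiv q) x \<noteq> 0)" for t
    unfolding g_def
    using gcd_pderiv_square_factor[where \<Phi> = "pencil \<phi> f t" and f = f, unfolded wronskian_pencil, OF W]
    by metis
  then obtain q where q: "\<And>t. pencil \<phi> f t = q t * (g t)\<^sup>2" "\<And>t. g t dvd wronskian \<phi> f"
    "\<And>t x. poly (g t) x = 0 \<Longrightarrow> poly (pderiv (g t)) x \<noteq> 0"
    "\<And>t x. poly (g t) x = 0 \<Longrightarrow> poly (q t) x \<noteq> 0"
    "\<And>t x. poly (q t) x = 0 \<Longrightarrow> poly (pderiv (q t)) x \<noteq> 0"
    by metis
  have g0: "g t \<noteq> 0" for t using q(2) W0 by (metis dvd_0_left)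
  have "(\<Prod>t\<in>T. g t) dvd wronskian \<phi> f"
  proof (rule prod_dvd_of_pairwise_coprime[OF finT q(2)])
    fix t t' :: complex assume "t \<noteq> t'"
    show "coprime (g t) (g t')"
    proof (rule coprime_complex_polyI[OF g0])
      fix x assume "poly (g t) x = 0"
      then have "poly (pencil \<phi> f t) x = 0" by (simp add: q(1))
      then show "poly (g t') x \<noteq> 0" using disjoint[of t x t'] \<open>t \<noteq> t'\<close> by (auto simp: q(1))
    qed
  qed
  then obtain k where k: "wronskian \<phi> f = (\<Prod>t\<in>T. g t) * k" by blast
  then have "k \<noteq> 0" using W0 by auto
  have "degree (\<Prod>t\<in>T. g t) = 2 * n - 2"
    using g0 total by (simp add: degree_prod_sum_eq)
  moreover have "degree (wronskian \<phi> f) = degree (\<Prod>t\<in>T. g t) + degree k"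
    unfolding k using g0 \<open>k \<noteq> 0\<close> finT by (intro degree_mult_eq) auto
  ultimately have "degree k = 0" using degree_wronskian_le[OF deg] by simp
  then obtain c where c: "k = [:c:]" by (meson degree_eq_zeroE)
  have WQ: "(wronskian \<phi> f)\<^sup>2 * (\<Prod>t\<in>T. q t) = smult (c\<^sup>2) (\<Prod>t\<in>T. pencil \<phi> f t)"
    unfolding k c by (simp add: q(1) prod.distrib prod_power_distrib[symmetric] power_mult_distrib power2_eq_square mult_ac)
  have pencil0: "pencil \<phi> f t \<noteq> 0" for t
    using W0 wronskian_pencil[of \<phi> f t] by auto
  have q0: "q t \<noteq> 0" for t using pencil0[of t] by (auto simp: q(1))
  have degq: "degree (q t) + 2 * degree (g t) \<le> n" for t
  proof -
    have "degree (pencil \<phi> f t) \<le> n"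
      unfolding pencil_def using deg by (intro degree_add_le) (auto intro: order_trans[OF degree_smult_le])
    then show ?thesis using q0[of t] g0[of t] by (simp add: q(1) degree_mult_eq degree_power_eq)
  qed
  \<comment> \<open>The bound is \<open>4 * n - 2 * (2 * n - 2) = 4\<close>. The degree drops when a
    pencil member has a point at infinity.\<close>
  have "(\<Sum>t\<in>T. degree (q t)) + 2 * (\<Sum>t\<in>T. degree (g t)) = (\<Sum>t\<in>T. degree (q t) + 2 * degree (g t))"
    by (simp add: sum.distrib sum_distrib_left)
  also have "\<dots> \<le> (\<Sum>t\<in>T. n)" by (intro sum_mono degq)
  also have "\<dots> = 4 * n" using T by simp
  finally have "degree (\<Prod>t\<in>T. q t) \<le> 4"
    using q0 total deg(3) by (simp add: degree_prod_sum_eq)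
  moreover have "poly (q t') x \<noteq> 0" if "poly (g t) x = 0" for t t' x
  proof
    assume "poly (q t') x = 0"
    then have "t = t'" using that by (intro disjoint[of t x t']) (simp_all add: q(1))
    then show False using q(4) that \<open>poly (q t') x = 0\<close> by blast
  qed
  ultimately show ?thesis using q(1,3,5) WQ by (intro that)
qed

section \<open>From integral curves to conic components of \<open>S\<close>\<close>

lemma infinite_affine_zeros_Darboux:
  assumes Y: "infinite Y" and P: "\<And>y. y \<in> Y \<Longrightarrow> \<exists>x. (x * y, - (x + y)) \<in> Z"
  shows "infinite (Z :: (complex \<times> complex) set)"
proof
  assume "finite Z"
  \<comment> \<open>A point of the chart has at most two Darboux coordinates, the roots of this
    quadratic.\<close>
  have "Y \<subseteq> (\<Union>(u, v)\<in>Z. {y. poly [:u, v, 1:] y = 0})"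
  proof
    fix y assume "y \<in> Y"
    then obtain x where "(x * y, - (x + y)) \<in> Z" using P by blast
    moreover have "poly [:x * y, - (x + y), 1:] y = 0" by (simp add: algebra_simps)
    ultimately show "y \<in> (\<Union>(u, v)\<in>Z. {y. poly [:u, v, 1:] y = 0})" by blast
  qed
  moreover have "finite (\<Union>(u, v)\<in>Z. {y. poly [:u, v, 1:] y = 0})"
    using \<open>finite Z\<close> by (intro finite_UN_I) (auto intro: poly_roots_finite simp del: poly_pCons)
  ultimately show False using Y finite_subset by blast
qed

text \<open>Composition with \<open>p\<close> moves \<open>e\<close> to 0, where the biquadratic is
  normalized: the quartic loses its constant term, and its linear coefficient \<open>A\<close> is
  the derivative of \<open>Q\<close> at \<open>e\<close>.\<close>

lemma poncelet_darboux_euler_conic: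
  fixes Q \<phi> f :: "complex poly" and e :: complex
  defines "p \<equiv> [:e, 1:]"
  defines "A \<equiv> coeff (pcompose Q p) 1" and "B \<equiv> coeff (pcompose Q p) 2"
    and "C \<equiv> coeff (pcompose Q p) 3" and "D \<equiv> coeff (pcompose Q p) 4"
  assumes S: "poncelet_darboux n \<phi> f S"
    and common: "\<not> (\<exists>z. poly \<phi> z = 0 \<and> poly f z = 0)"
    and T: "card T = 4" "t1 \<in> T"
    and W0: "wronskian \<phi> f \<noteq> 0"
    and W: "(wronskian \<phi> f)\<^sup>2 * Q = smult \<kappa> (\<Prod>t\<in>T. pencil \<phi> f t)" and deg: "degree Q \<le> 4"
    and e: "poly Q e = 0" "poly (pderiv Q) e \<noteq> 0" "poly (pencil \<phi> f t1) e = 0"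
    and \<beta>: "poly Q \<beta> \<noteq> 0" "poly (pencil \<phi> f t1) \<beta> = 0"
  shows "prime_conic (euler_conic A B C D e (\<beta> - e))"
    and "infinite (affine_zeros S \<inter> affine_zeros (euler_conic A B C D e (\<beta> - e)))"
    and "A \<noteq> 0"
proof -
  have Q: "pcompose Q p = [:0, A, B, C, D:]"
  proof (rule poly_eqI)
    fix i
    have "coeff (pcompose Q p) 0 = 0" using e(1) by (simp add: p_def coeff_pcompose_0)
    moreover have "degree (pcompose Q p) \<le> 4" using deg by (simp add: p_def degree_pcompose)
    then have "coeff (pcompose Q p) i = 0" if "i > 4" using that by (intro coeff_eq_0) simp
    ultimately show "coeff (pcompose Q p) i = coeff [:0, A, B, C, D:] i"
      by (auto simp: A_def B_def C_def D_def coeff_pCons numeral_eq_Suc split: nat.splits)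
  qed
  have "poly (pderiv (pcompose Q p)) 0 = poly (pderiv Q) e"
    by (simp add: pderiv_pcompose p_def poly_pcompose pderiv_pCons)
  then show A: "A \<noteq> 0" using e(2) unfolding Q by (simp add: pderiv_pCons)
  define b where "b = \<beta> - e"
  have "\<beta> \<noteq> e" using e \<beta> by auto
  then have b: "b \<noteq> 0" by (simp add: b_def)
  have Qb: "poly [:0, A, B, C, D:] b \<noteq> 0"
    using \<beta>(1) unfolding Q[symmetric] by (simp add: poly_pcompose p_def b_def)
  define \<phi>' f' where "\<phi>' = pcompose \<phi> p" and "f' = pcompose f p"
  have W': "wronskian \<phi>' f' = pcompose (wronskian \<phi> f) p"
    unfolding \<phi>'_def f'_def by (simp add: pderiv_pcompose pcompose_diff pcompose_mult p_def pderiv_pCons)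
  have pencil': "pencil \<phi>' f' t = pcompose (pencil \<phi> f t) p" for t
    unfolding \<phi>'_def f'_def by (simp add: pencil_def pcompose_add pcompose_smult)
  have poly_f': "poly f' x = poly f (e + x)" for x
    by (simp add: f'_def poly_pcompose p_def)
  have fz: "poly f z \<noteq> 0" if "poly (pencil \<phi> f t1) z = 0" for z
    using that common by (auto simp: pencil_def)
  have inf: "infinite {y. \<exists>x. x \<noteq> y \<and> A + D * b * x * y \<noteq> 0 \<and>
      euler_biquadratic A B C D b x y = 0 \<and> poly \<phi>' x * poly f' y = poly \<phi>' y * poly f' x}"
    (is "infinite ?Y")
  proof (rule infinite_euler_biquadratic_points[OF A b Qb _ T])
    show "wronskian \<phi>' f' \<noteq> 0"
      unfolding W' using W0 by (simp add: p_def pcompose_eq_0_iff)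
    have "pcompose ((wronskian \<phi> f)\<^sup>2 * Q) p = pcompose (smult \<kappa> (\<Prod>t\<in>T. pencil \<phi> f t)) p"
      using W by simp
    then show "(wronskian \<phi>' f')\<^sup>2 * [:0, A, B, C, D:] = smult \<kappa> (\<Prod>t\<in>T. pencil \<phi>' f' t)"
      unfolding W' pencil' Q[symmetric]
      by (simp add: pcompose_mult pcompose_smult pcompose_prod power2_eq_square)
  qed (use fz[OF e(3)] fz[OF \<beta>(2)] e(3) \<beta>(2) in
      \<open>simp_all add: pencil' poly_f' poly_pcompose p_def b_def\<close>)
  have "infinite ((\<lambda>y. y + e) ` ?Y)" using inf by (simp add: finite_image_iff)
  then have Z: "infinite (affine_zeros S \<inter> affine_zeros (euler_conic A B C D e b))"
  proof (rule infinite_affine_zeros_Darboux)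
    fix y assume "y \<in> (\<lambda>y. y + e) ` ?Y"
    then obtain x where x: "x \<noteq> y - e" "euler_biquadratic A B C D b x (y - e) = 0"
      "poly \<phi>' x * poly f' (y - e) = poly \<phi>' (y - e) * poly f' x" by auto
    have "euler_conic A B C D e b ((x + e) * y) (- (x + e + y)) 1 = 0"
      unfolding euler_conic_Darboux using x(2) by simp
    moreover have "(x + e - y) * S ((x + e) * y) (- (x + e + y)) 1 =
        poly \<phi> (x + e) * poly f y - poly \<phi> y * poly f (x + e)"
      using S unfolding poncelet_darboux_def by blast
    then have "(x + e - y) * S ((x + e) * y) (- (x + e + y)) 1 = 0"
      using x(3) by (simp add: \<phi>'_def f'_def poly_pcompose p_def add.commute)
    then have "S ((x + e) * y) (- (x + e + y)) 1 = 0" using x(1) by auto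
    ultimately show "\<exists>x. (x * y, - (x + y)) \<in> affine_zeros S \<inter> affine_zeros (euler_conic A B C D e b)"
      unfolding affine_zeros_def by blast
  qed
  then show "infinite (affine_zeros S \<inter> affine_zeros (euler_conic A B C D e (\<beta> - e)))"
    by (simp add: b_def)
  have "infinite (affine_zeros (euler_conic A B C D e b))" using Z by auto
  from prime_conic_euler_conic[OF A b Qb this]
  show "prime_conic (euler_conic A B C D e (\<beta> - e))" by (simp add: b_def)
qed

text \<open>The conditions on \<open>t1\<close> give \<open>q t1\<close> positive degree, hence a
  finite simple point \<open>e\<close>. This one \<open>e\<close> is paired with each double point
  of the fibre.\<close>

lemma poncelet_darboux_conics:
  fixes \<phi> f :: "complex poly" and T :: "complex set"
  assumes deg: "degree \<phi> = n" "degree f = n" "n \<ge> 1"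
    and common: "\<not> (\<exists>z. poly \<phi> z = 0 \<and> poly f z = 0)"
    and S: "poncelet_darboux n \<phi> f S" and tr: "transversal S conic_K"
    and T: "card T = 4" "t1 \<in> T"
  defines "g \<equiv> \<lambda>t. gcd (pencil \<phi> f t) (pderiv (pencil \<phi> f t))"
  assumes total: "(\<Sum>t\<in>T. degree (g t)) = 2 * n - 2"
    and t1: "degree (pencil \<phi> f t1) = n" "2 * degree (g t1) < n"
  shows "\<exists>Qs U. length Qs = degree (g t1) \<and> (\<forall>Q\<in>set Qs. prime_conic Q) \<and> distinct (map curve Qs) \<and>
     is_form (n - 1 - 2 * degree (g t1)) U \<and> U \<noteq> (\<lambda>_ _ _. 0) \<and>
     (\<forall>x y z. S x y z = U x y z * (\<Prod>C\<leftarrow>Qs. C x y z))"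
proof -
  note W = transversal_simple_roots[OF S tr]
  have g_eq: "gcd (pencil \<phi> f t) (pderiv (pencil \<phi> f t)) = g t" for t
    by (simp add: g_def)
  obtain q \<kappa> where q: "\<And>t. pencil \<phi> f t = q t * (g t)\<^sup>2"
    "\<And>t x. poly (g t) x = 0 \<Longrightarrow> poly (pderiv (g t)) x \<noteq> 0"
    "\<And>t t' x. poly (g t) x = 0 \<Longrightarrow> poly (q t') x \<noteq> 0"
    "\<And>t x. poly (q t) x = 0 \<Longrightarrow> poly (pderiv (q t)) x \<noteq> 0"
    and WQ: "(wronskian \<phi> f)\<^sup>2 * (\<Prod>t\<in>T. q t) = smult \<kappa> (\<Prod>t\<in>T. pencil \<phi> f t)"
    and degQ: "degree (\<Prod>t\<in>T. q t) \<le> 4"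
    by (rule wronskian_square_factor[OF deg common W T(1), unfolded g_eq, OF _ total],
        assumption, rule that)
  have finT: "finite T" using T card_ge_0_finite[of T] by simp
  have W0: "wronskian \<phi> f \<noteq> 0" using W by force
  have "pencil \<phi> f t1 \<noteq> 0" using W0 wronskian_pencil[of \<phi> f t1] by auto
  then have nz: "q t1 \<noteq> 0" "g t1 \<noteq> 0" by (auto simp: q(1))
  then have "n = degree (q t1) + 2 * degree (g t1)"
    using t1(1) by (simp add: q(1) degree_mult_eq degree_power_eq)
  then have "degree (q t1) > 0" using t1(2) by simp
  then obtain e where e: "poly (q t1) e = 0" using alg_closed_imp_poly_has_root by blast
  define Q where "Q = (\<Prod>t\<in>T. q t)"
  \<comment> \<open>Needed for \<open>e\<close> to be a simple root of the whole product
    \<open>Q\<close>; a root shared by two pencil members would be a common zero of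
    \<open>\<phi>\<close> and \<open>f\<close>.\<close>
  have q_e: "poly (q t) e \<noteq> 0" if "t \<noteq> t1" for t
  proof
    assume "poly (q t) e = 0"
    then have "poly \<phi> e + t * poly f e = 0" "poly \<phi> e + t1 * poly f e = 0"
      using e arg_cong[OF q(1)[of t], of "\<lambda>p. poly p e"] arg_cong[OF q(1)[of t1], of "\<lambda>p. poly p e"]
      by (simp_all add: pencil_def)
    then have "(t - t1) * poly f e = 0" "poly \<phi> e = - t1 * poly f e" by algebra+
    then show False using that common by auto
  qed
  have Q_split: "Q = q t1 * (\<Prod>t\<in>T - {t1}. q t)"
    unfolding Q_def using finT T(2) by (rule prod.remove)
  have Qe: "poly Q e = 0" "poly (pderiv Q) e \<noteq> 0"
    using e q(4)[OF e] q_e finT by (auto simp: Q_split pderiv_mult poly_prod)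
  have pe: "poly (pencil \<phi> f t1) e = 0" using e by (simp add: q(1))
  define A B C D where "A = coeff (pcompose Q [:e, 1:]) 1" and "B = coeff (pcompose Q [:e, 1:]) 2"
    and "C = coeff (pcompose Q [:e, 1:]) 3" and "D = coeff (pcompose Q [:e, 1:]) 4"
  define Qc where "Qc = (\<lambda>\<beta>. euler_conic A B C D e (\<beta> - e))"
  have conic: "prime_conic (Qc \<beta>)" "infinite (affine_zeros S \<inter> affine_zeros (Qc \<beta>))" "A \<noteq> 0"
    if "poly (g t1) \<beta> = 0" for \<beta>
  proof -
    have "poly Q \<beta> \<noteq> 0" "poly (pencil \<phi> f t1) \<beta> = 0"
      using q(3)[OF that] that finT by (simp_all add: Q_def poly_prod q(1))
    note * = poncelet_darboux_euler_conic[OF S common T W0 WQ degQ, folded Q_def, OF Qe pe this]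
    show "prime_conic (Qc \<beta>)" "infinite (affine_zeros S \<inter> affine_zeros (Qc \<beta>))" "A \<noteq> 0"
      using * unfolding Qc_def A_def B_def C_def D_def by blast+
  qed
  \<comment> \<open>For \<open>\<beta> \<noteq> \<beta>'\<close> the contact point of one conic is
    off the other; this gives both finite intersections and distinct curves.\<close>
  have at_base: "Qc \<beta> (e * \<beta>') (- (e + \<beta>')) 1 = A\<^sup>2 * (\<beta>' - \<beta>)\<^sup>2" for \<beta> \<beta>'
    unfolding Qc_def euler_conic_at_base by simp
  obtain bs where bs: "set bs = {x. poly (g t1) x = 0}" "distinct bs"
    using finite_distinct_list[OF poly_roots_finite[OF nz(2)]] by blast
  have len: "length bs = degree (g t1)"
    using card_simple_roots[of "g t1"] q(2) bs by (metis distinct_card)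
  have form: "is_form (n - 1) S" using S by (simp add: poncelet_darboux_def)
  have "\<exists>U. is_form (n - 1 - 2 * length bs) U \<and> (\<forall>x y z. S x y z = U x y z * (\<Prod>C\<leftarrow>map Qc bs. C x y z))"
  proof (rule prime_conics_prod_dvd[OF bs(2) _ _ form])
    fix \<beta> \<beta>' assume "\<beta> \<in> set bs" "\<beta>' \<in> set bs" "\<beta> \<noteq> \<beta>'"
    then show "finite (affine_zeros (Qc \<beta>') \<inter> affine_zeros (Qc \<beta>))"
      using conic at_base[of \<beta> \<beta>'] at_base[of \<beta>' \<beta>'] bs(1)
      by (intro prime_conics_finite_inter[of _ _ "e * \<beta>'" "- (e + \<beta>')" 1]) auto
  qed (use conic bs(1) in auto)
  then obtain U where U: "is_form (n - 1 - 2 * length bs) U"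
    "\<And>x y z. S x y z = U x y z * (\<Prod>C\<leftarrow>map Qc bs. C x y z)" by blast
  have "U \<noteq> (\<lambda>_ _ _. 0)"
  proof
    assume "U = (\<lambda>_ _ _. 0)"
    then have "poly (wronskian \<phi> f) x = 0" for x
      using poncelet_darboux_on_conic_K[OF S, of x] U(2) by simp
    then show False using W0 poly_all_0_iff_0 by blast
  qed
  moreover have "distinct (map curve (map Qc bs))"
    unfolding map_map distinct_map
  proof (intro conjI bs(2) inj_onI)
    fix \<beta> \<beta>' assume *: "\<beta> \<in> set bs" "\<beta>' \<in> set bs" "(curve \<circ> Qc) \<beta> = (curve \<circ> Qc) \<beta>'"
    have "(e * \<beta>', - (e + \<beta>'), 1) \<in> curve (Qc \<beta>')"
      using at_base[of \<beta>' \<beta>'] by (simp add: curve_def)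
    then have "(e * \<beta>', - (e + \<beta>'), 1) \<in> curve (Qc \<beta>)" using *(3) by simp
    then have "Qc \<beta> (e * \<beta>') (- (e + \<beta>')) 1 = 0" by (simp add: curve_def)
    then show "\<beta> = \<beta>'" using at_base[of \<beta> \<beta>'] conic(3) *(1) bs(1) by auto
  qed
  ultimately show ?thesis
    using U conic bs(1) len by (intro exI[of _ "map Qc bs"] exI[of _ U]) auto
qed

section \<open>The remaining factor and the two cases\<close>

lemma completely_decomposedI:
  assumes "distinct (map curve Cs)" "c \<noteq> 0" "\<And>x y z. S x y z = c * (\<Prod>C\<leftarrow>Cs. C x y z)"
  shows "completely_decomposed S Cs"
proof -
  have "curve S = (\<Union>C \<in> set Cs. curve C)"
    using assms(2) by (auto simp: curve_def assms(3) prod_list_zero_iff)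
  then show ?thesis using assms unfolding completely_decomposed_def by blast
qed

lemma prime_conic_curve_neq_line:
  assumes Q: "prime_conic Q" and L: "is_form 1 L" "L \<noteq> (\<lambda>_ _ _. 0)"
  shows "curve L \<noteq> curve Q"
proof
  assume "curve L = curve Q"
  moreover have "affine_zeros F = {(x, y). (x, y, 1) \<in> curve F}" for F
    by (simp add: affine_zeros_def curve_def)
  ultimately have "affine_zeros L \<inter> affine_zeros Q = affine_zeros Q" by simp
  then have "infinite (affine_zeros L \<inter> affine_zeros Q)" using Q by (simp add: prime_conic_def)
  then have "L = (\<lambda>_ _ _. 0)"
    using prime_conic_dvd[OF Q L(1)] by (metis mult_zero_right one_less_numeral_iff semiring_norm(76) ext)
  then show False using L(2) by simp
qed

text \<open>The leading coefficient of the pencil member is a non-constant affine function of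
  \<open>t\<close>, so it vanishes only once.\<close>

lemma pencil_degree_eq:
  assumes "degree \<phi> = n" "degree f = n" "n \<ge> 1" "t \<noteq> t'"
  shows "degree (pencil \<phi> f t) = n \<or> degree (pencil \<phi> f t') = n"
proof (rule ccontr)
  assume *: "\<not> (degree (pencil \<phi> f t) = n \<or> degree (pencil \<phi> f t') = n)"
  have "coeff (pencil \<phi> f s) n = 0" if "degree (pencil \<phi> f s) \<noteq> n" for s
  proof -
    have "degree (pencil \<phi> f s) \<le> n"
      unfolding pencil_def using assms by (intro degree_add_le) (auto intro: order_trans[OF degree_smult_le])
    then show ?thesis using that by (intro coeff_eq_0) simp
  qed
  then have "coeff \<phi> n + t * coeff f n = 0" "coeff \<phi> n + t' * coeff f n = 0"
    using * by (auto simp: pencil_def)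
  then have "(t - t') * coeff f n = 0" by algebra
  then show False using assms leading_coeff_0_iff[of f] by auto
qed

theorem theorem12:
  fixes n r m :: nat and \<phi> f :: "complex poly" and S :: ternary
  assumes "n = 2 ^ r * m" and "odd m" and "r \<in> {0, 1}"
    and "degree \<phi> = n" and "degree f = n"
    and "\<not> (\<exists>z. poly \<phi> z = 0 \<and> poly f z = 0)"
    and "poncelet_darboux n \<phi> f S"
    and "transversal S conic_K"
  shows "(\<forall>k. r = 0 \<and> n = 2 * k + 1 \<and>
           (\<exists>t1 t2 t3 t4. distinct [t1, t2, t3, t4] \<and>
              (\<forall>t \<in> {t1, t2, t3, t4}.
                 degree (gcd (pencil \<phi> f t) (pderiv (pencil \<phi> f t))) = k))
           \<longrightarrow> (\<exists>Qs. length Qs = k \<and> (\<forall>Q \<in> set Qs. irreducible_conic Q) \<and>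
                 completely_decomposed S Qs)) \<and>
         (\<forall>k. r = 1 \<and> n = 2 * k \<and>
           (\<exists>t1 t2 t3 t4. distinct [t1, t2, t3, t4] \<and>
              (\<forall>t \<in> {t1, t2}.
                 degree (gcd (pencil \<phi> f t) (pderiv (pencil \<phi> f t))) = k) \<and>
              (\<forall>t \<in> {t3, t4}.
                 degree (gcd (pencil \<phi> f t) (pderiv (pencil \<phi> f t))) = k - 1))
           \<longrightarrow> (\<exists>L Qs. line L \<and> length Qs = k - 1 \<and> (\<forall>Q \<in> set Qs. irreducible_conic Q) \<and>
                 completely_decomposed S (L # Qs)))"
proof (intro conjI allI impI)
  have "m > 0" using assms(2) by (rule odd_pos)
  then have n: "n \<ge> 1" using assms(1) by (simp add: Suc_le_eq)
  define g where "g = (\<lambda>t. gcd (pencil \<phi> f t) (pderiv (pencil \<phi> f t)))"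
  have g_eq: "gcd (pencil \<phi> f t) (pderiv (pencil \<phi> f t)) = g t" for t
    by (simp add: g_def)
  note conics = poncelet_darboux_conics[OF assms(4,5) n assms(6-8), unfolded g_eq]
  {
    fix k assume "r = 0 \<and> n = 2 * k + 1 \<and> (\<exists>t1 t2 t3 t4. distinct [t1, t2, t3, t4] \<and>
      (\<forall>t \<in> {t1, t2, t3, t4}. degree (gcd (pencil \<phi> f t) (pderiv (pencil \<phi> f t))) = k))"
    then obtain t1 t2 t3 t4 where nk: "n = 2 * k + 1" and t: "distinct [t1, t2, t3, t4]"
      and g: "\<And>t. t \<in> {t1, t2, t3, t4} \<Longrightarrow> degree (g t) = k" unfolding g_def by blast
    define T where "T = {t1, t2, t3, t4}"
    have T: "card T = 4" "(\<Sum>t\<in>T. degree (g t)) = 2 * n - 2"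
      using t g nk by (simp_all add: T_def)
    obtain s where s: "s \<in> T" "degree (pencil \<phi> f s) = n"
      using pencil_degree_eq[OF assms(4,5) n, of t1 t2] t by (auto simp: T_def)
    have "degree (g s) = k" using g s(1) by (simp add: T_def)
    with conics[OF T(1) s(1) T(2) s(2)] nk
    obtain Qs U where Qs: "length Qs = k" "\<forall>Q\<in>set Qs. prime_conic Q" "distinct (map curve Qs)"
      and U: "is_form 0 U" "U \<noteq> (\<lambda>_ _ _. 0)" "\<And>x y z. S x y z = U x y z * (\<Prod>C\<leftarrow>Qs. C x y z)"
      by auto
    have const: "U x y z = U 0 0 0" for x y z by (rule is_form_0_const[OF U(1)])
    have "U 0 0 0 \<noteq> 0"
    proof
      assume "U 0 0 0 = 0"
      then have "U = (\<lambda>_ _ _. 0)" by (intro ext) (metis const)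
      then show False using U(2) by simp
    qed
    moreover have "S x y z = U 0 0 0 * (\<Prod>C\<leftarrow>Qs. C x y z)" for x y z
      using U(3)[of x y z] const[of x y z] by simp
    ultimately have "completely_decomposed S Qs"
      by (rule completely_decomposedI[OF Qs(3)])
    then show "\<exists>Qs. length Qs = k \<and> (\<forall>Q \<in> set Qs. irreducible_conic Q) \<and> completely_decomposed S Qs"
      using Qs prime_conic_irreducible by blast
  next
    fix k assume "r = 1 \<and> n = 2 * k \<and> (\<exists>t1 t2 t3 t4. distinct [t1, t2, t3, t4] \<and>
      (\<forall>t \<in> {t1, t2}. degree (gcd (pencil \<phi> f t) (pderiv (pencil \<phi> f t))) = k) \<and>
      (\<forall>t \<in> {t3, t4}. degree (gcd (pencil \<phi> f t) (pderiv (pencil \<phi> f t))) = k - 1))"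
    then obtain t1 t2 t3 t4 where nk: "n = 2 * k" and t: "distinct [t1, t2, t3, t4]"
      and g: "\<And>t. t \<in> {t1, t2} \<Longrightarrow> degree (g t) = k" "\<And>t. t \<in> {t3, t4} \<Longrightarrow> degree (g t) = k - 1"
      unfolding g_def by blast
    define T where "T = {t1, t2, t3, t4}"
    have T: "card T = 4" "(\<Sum>t\<in>T. degree (g t)) = 2 * n - 2"
      using t g nk n by (simp_all add: T_def)
    \<comment> \<open>The fibres of \<open>t1\<close> and \<open>t2\<close> have no simple point to
      serve as \<open>e\<close>, since \<open>2 * k = n\<close>; hence the choice between
      \<open>t3\<close> and \<open>t4\<close>.\<close>
    obtain s where s: "s \<in> {t3, t4}" "degree (pencil \<phi> f s) = n"
      using pencil_degree_eq[OF assms(4,5) n, of t3 t4] t by auto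
    have gs: "degree (g s) = k - 1" using g s(1) by blast
    have "s \<in> T" using s(1) by (auto simp: T_def)
    from conics[OF T(1) this T(2) s(2)] gs nk n
    obtain Qs U where Qs: "length Qs = k - 1" "\<forall>Q\<in>set Qs. prime_conic Q" "distinct (map curve Qs)"
      and U: "is_form (n - 1 - 2 * (k - 1)) U" "U \<noteq> (\<lambda>_ _ _. 0)"
        "\<And>x y z. S x y z = U x y z * (\<Prod>C\<leftarrow>Qs. C x y z)"
      by auto
    have "n - 1 - 2 * (k - 1) = 1" using nk n by simp
    then have U1: "is_form 1 U" using U(1) by simp
    then have "line U" using U(2) by (auto simp: line_def fun_eq_iff)
    moreover have "distinct (map curve (U # Qs))"
      using Qs prime_conic_curve_neq_line[OF _ U1 U(2)] by auto
    then have "completely_decomposed S (U # Qs)"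
      by (rule completely_decomposedI[of _ 1]) (simp_all add: U(3))
    ultimately show "\<exists>L Qs. line L \<and> length Qs = k - 1 \<and> (\<forall>Q \<in> set Qs. irreducible_conic Q) \<and>
        completely_decomposed S (L # Qs)"
      using Qs prime_conic_irreducible by blast
  }
qed

end
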